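(* Let $r=\sqrt{415}$. The explicit 8-stage Runge--Kutta method with abscissae $c=(0,\tfrac12,1,\tfrac15,\tfrac25,\tfrac35,1,\tfrac45)$, weights $$b=\Big(\tfrac{19}{288},\,0,\,0,\,\tfrac{25}{96},\,\tfrac{25}{144},\,\tfrac{25}{144},\,\tfrac{19}{288},\,\tfrac{25}{96}\Big)$$ and coefficients (all other $a_{ij}$ being $0$) - $a_{21}=\frac12$; - $a_{31}=0,\ a_{32}=1$; - $a_{41}=\frac{16}{125},\ a_{42}=\frac{13}{125},\ a_{43}=-\frac{4}{125}$; - $a_{51}=\frac{-136-2r}{2875},\ a_{52}=\frac{-638-6r}{2875},\ a_{53}=\frac{821+7r}{11500},\ a_{54}=\frac{275+r}{460}$; - $a_{61}=\frac{2469-31r}{40250},\ a_{62}=\frac{-777+18r}{2875},\ a_{63}=\frac{18979-326r}{241500},\ a_{64}=\frac{895+2r}{3220},\ a_{65}=\frac{95-r}{210}$; - $a_{71}=\frac{91295-6701r}{45885},\ a_{72}=\frac{-1415+12r}{2185},\ a_{73}=\frac{75035-3252r}{91770},\ a_{74}=\frac{-42285+3300r}{6118},\ a_{75}=\frac{4115-285r}{399},\ a_{76}=\frac{-260+20r}{57}$; - $a_{81}=\frac{-77534+6878r}{181125},\ a_{82}=\frac{1116-12r}{2875},\ a_{83}=\frac{-3216783+103963r}{14852250},\ a_{84}=\frac{3489-223r}{1610},\ a_{85}=\frac{-918+58r}{315},\ a_{86}=\frac{82-4r}{45},\ a_{87}=\frac{-285+38r}{15375}$ is of order $6$ for scalar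 non-autonomous problems $y'(x)=f(y(x),x)$, $y(x)\in\mathbb{R}$, but only of order $5$ (that is, of order $5$ and not of order $6$) for vector problems $\mathbf{y}'(x)=\mathbf{f}(\mathbf{y}(x))$, $\mathbf{y}(x)\in\mathbb{R}^d$, $d\ge1$ arbitrary.
   Context: For $y'(x)=f(y(x),x)$, $y(x_0)=y_0$, an explicit Runge--Kutta method $(A,b,c)$ with step size $h$ produces $y_1=y_0+h\sum_i b_i f(Y_i,x_0+c_ih)$, where $Y_i=y_0+h\sum_{j<i}a_{ij}f(Y_j,x_0+c_jh)$. For autonomous problems the second argument of $f$ is absent. The method is of order $p$ for scalar problems if, for every $C^\infty$ function $f$ defined near $(y_0,x_0)\in\mathbb{R}\times\mathbb{R}$, $y_1-y(x_0+h)=O(h^{p+1})$ as $h\to0$. It is of order $p$ for vector problems if, for every $d\ge1$ and every $C^\infty$ function $\mathbf{f}$ defined near $\mathbf{y}_0\in\mathbb{R}^d$ with values in $\mathbb{R}^d$, $\mathbf{y}_1-\mathbf{y}(x_0+h)=O(h^{p+1})$ as $h\to0$. *)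

theory Defs
  imports "HOL-Analysis.Analysis" "HOL-Library.Landau_Symbols" "HOL-Library.More_List"
begin

text \<open>
  The dimension \<open>d\<close> of a vector problem is quantified inside the notion of order, so
  \<open>\<real>\<^sup>d\<close> is rendered by the library's \<^const>\<open>Euclidean_space\<close>: the functions
  \<open>nat \<Rightarrow> real\<close> that vanish at all indices \<open>\<ge> d\<close>, with the Euclidean topology.
\<close>

primrec Ck_on :: "nat \<Rightarrow> nat \<Rightarrow> (nat \<Rightarrow> real) set \<Rightarrow> ((nat \<Rightarrow> real) \<Rightarrow> real) \<Rightarrow> bool" where
  "Ck_on d 0 U g \<longleftrightarrow> continuous_map (subtopology (Euclidean_space d) U) euclideanreal g"
| "Ck_on d (Suc k) U g \<longleftrightarrow>
     continuous_map (subtopology (Euclidean_space d) U) euclideanreal g \<and>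
     (\<forall>i<d. \<exists>g'. (\<forall>z\<in>U. ((\<lambda>t. g (z(i := t))) has_real_derivative g' z) (at (z i))) \<and>
                 Ck_on d k U g')"

definition smooth_on :: "nat \<Rightarrow> (nat \<Rightarrow> real) set \<Rightarrow> ((nat \<Rightarrow> real) \<Rightarrow> real) \<Rightarrow> bool" where
  "smooth_on d U g \<longleftrightarrow> (\<forall>k. Ck_on d k U g)"

text \<open>
  Functions are total in HOL; only the values of the right-hand side on the neighbourhood \<open>U\<close> matter
  for small step sizes.
\<close>

definition smooth_near_scalar :: "(real \<Rightarrow> real \<Rightarrow> real) \<Rightarrow> real \<Rightarrow> real \<Rightarrow> bool" where
  "smooth_near_scalar f y0 x0 \<longleftrightarrow>
     (\<exists>U. openin (Euclidean_space 2) U \<and> (\<lambda>_. 0)(0 := y0, 1 := x0) \<in> U \<and>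
          smooth_on 2 U (\<lambda>z. f (z 0) (z 1)))"

definition smooth_near_vector :: "nat \<Rightarrow> ((nat \<Rightarrow> real) \<Rightarrow> nat \<Rightarrow> real) \<Rightarrow> (nat \<Rightarrow> real) \<Rightarrow> bool" where
  "smooth_near_vector d f y0 \<longleftrightarrow>
     (\<exists>U. openin (Euclidean_space d) U \<and> y0 \<in> U \<and>
          (\<forall>z\<in>U. f z \<in> topspace (Euclidean_space d)) \<and>
          (\<forall>i<d. smooth_on d U (\<lambda>z. f z i)))"

text \<open>
  An explicit method with \<open>s\<close> stages is given by \<open>A :: nat \<Rightarrow> nat \<Rightarrow> real\<close> and
  \<open>b, c :: nat \<Rightarrow> real\<close>. Stages are numbered \<open>0, \<dots>, s - 1\<close>, and only the
  entries \<open>A i j\<close> with \<open>j < i < s\<close> are used.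
\<close>

fun rk_stage_scalar ::
  "(nat \<Rightarrow> nat \<Rightarrow> real) \<Rightarrow> (nat \<Rightarrow> real) \<Rightarrow> (real \<Rightarrow> real \<Rightarrow> real) \<Rightarrow> real \<Rightarrow> real \<Rightarrow> real \<Rightarrow> nat \<Rightarrow> real"
where
  "rk_stage_scalar A c f y0 x0 h i =
     y0 + h * (\<Sum>j<i. A i j * f (rk_stage_scalar A c f y0 x0 h j) (x0 + c j * h))"

definition rk_step_scalar ::
  "nat \<Rightarrow> (nat \<Rightarrow> nat \<Rightarrow> real) \<Rightarrow> (nat \<Rightarrow> real) \<Rightarrow> (nat \<Rightarrow> real) \<Rightarrow>
   (real \<Rightarrow> real \<Rightarrow> real) \<Rightarrow> real \<Rightarrow> real \<Rightarrow> real \<Rightarrow> real" where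
  "rk_step_scalar s A b c f y0 x0 h =
     y0 + h * (\<Sum>i<s. b i * f (rk_stage_scalar A c f y0 x0 h i) (x0 + c i * h))"

fun rk_stage_vector ::
  "(nat \<Rightarrow> nat \<Rightarrow> real) \<Rightarrow> ((nat \<Rightarrow> real) \<Rightarrow> nat \<Rightarrow> real) \<Rightarrow> (nat \<Rightarrow> real) \<Rightarrow> real \<Rightarrow> nat \<Rightarrow> nat \<Rightarrow> real"
where
  "rk_stage_vector A f y0 h i =
     (\<lambda>k. y0 k + h * (\<Sum>j<i. A i j * f (rk_stage_vector A f y0 h j) k))"

definition rk_step_vector ::
  "nat \<Rightarrow> (nat \<Rightarrow> nat \<Rightarrow> real) \<Rightarrow> (nat \<Rightarrow> real) \<Rightarrow>
   ((nat \<Rightarrow> real) \<Rightarrow> nat \<Rightarrow> real) \<Rightarrow> (nat \<Rightarrow> real) \<Rightarrow> real \<Rightarrow> nat \<Rightarrow> real" where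
  "rk_step_vector s A b f y0 h =
     (\<lambda>k. y0 k + h * (\<Sum>i<s. b i * f (rk_stage_vector A f y0 h i) k))"

declare rk_stage_scalar.simps [simp del] rk_stage_vector.simps [simp del]

text \<open>
  The exact solution is the germ at \<open>x0\<close> of a solution of the initial value problem; it exists and is
  unique for smooth right-hand sides, so quantifying over all such \<open>y\<close> is harmless.
\<close>

definition solves_scalar :: "(real \<Rightarrow> real \<Rightarrow> real) \<Rightarrow> real \<Rightarrow> real \<Rightarrow> (real \<Rightarrow> real) \<Rightarrow> bool" where
  "solves_scalar f y0 x0 y \<longleftrightarrow>
     y x0 = y0 \<and> (\<forall>\<^sub>F x in nhds x0. (y has_real_derivative f (y x) x) (at x))"

definition solves_vector ::
  "nat \<Rightarrow> ((nat \<Rightarrow> real) \<Rightarrow> nat \<Rightarrow> real) \<Rightarrow> (nat \<Rightarrow> real) \<Rightarrow> real \<Rightarrow> (real \<Rightarrow> nat \<Rightarrow> real) \<Rightarrow> bool" where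
  "solves_vector d f y0 x0 y \<longleftrightarrow>
     y x0 = y0 \<and>
     (\<forall>\<^sub>F x in nhds x0. y x \<in> topspace (Euclidean_space d) \<and>
        (\<forall>i<d. ((\<lambda>t. y t i) has_real_derivative f (y x) i) (at x)))"

definition rk_order_scalar ::
  "nat \<Rightarrow> (nat \<Rightarrow> nat \<Rightarrow> real) \<Rightarrow> (nat \<Rightarrow> real) \<Rightarrow> (nat \<Rightarrow> real) \<Rightarrow> nat \<Rightarrow> bool" where
  "rk_order_scalar s A b c p \<longleftrightarrow>
     (\<forall>f y0 x0 y. smooth_near_scalar f y0 x0 \<and> solves_scalar f y0 x0 y \<longrightarrow>
        (\<lambda>h. rk_step_scalar s A b c f y0 x0 h - y (x0 + h)) \<in> O[at 0](\<lambda>h. h ^ (p + 1)))"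

definition rk_order_vector ::
  "nat \<Rightarrow> (nat \<Rightarrow> nat \<Rightarrow> real) \<Rightarrow> (nat \<Rightarrow> real) \<Rightarrow> nat \<Rightarrow> bool" where
  "rk_order_vector s A b p \<longleftrightarrow>
     (\<forall>d\<ge>1. \<forall>f y0 x0 y. smooth_near_vector d f y0 \<and> solves_vector d f y0 x0 y \<longrightarrow>
        (\<lambda>h. L2_set (\<lambda>k. rk_step_vector s A b f y0 h k - y (x0 + h) k) {..<d})
          \<in> O[at 0](\<lambda>h. h ^ (p + 1)))"

definition butcher_c :: "nat \<Rightarrow> real" where
  "butcher_c = nth_default 0 [0, 1/2, 1, 1/5, 2/5, 3/5, 1, 4/5]"

definition butcher_b :: "nat \<Rightarrow> real" where
  "butcher_b = nth_default 0 [19/288, 0, 0, 25/96, 25/144, 25/144, 19/288, 25/96]"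

definition butcher_A :: "nat \<Rightarrow> nat \<Rightarrow> real" where
  "butcher_A i j = (let r = sqrt 415 in
     nth_default 0 (nth_default []
      [[],
       [1/2],
       [0, 1],
       [16/125, 13/125, -4/125],
       [(-136 - 2*r)/2875, (-638 - 6*r)/2875, (821 + 7*r)/11500, (275 + r)/460],
       [(2469 - 31*r)/40250, (-777 + 18*r)/2875, (18979 - 326*r)/241500, (895 + 2*r)/3220,
        (95 - r)/210],
       [(91295 - 6701*r)/45885, (-1415 + 12*r)/2185, (75035 - 3252*r)/91770,
        (-42285 + 3300*r)/6118, (4115 - 285*r)/399, (-260 + 20*r)/57],
       [(-77534 + 6878*r)/181125, (1116 - 12*r)/2875, (-3216783 + 103963*r)/14852250,
        (3489 - 223*r)/1610, (-918 + 58*r)/315, (82 - 4*r)/45, (-285 + 38*r)/15375]] i) j)"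

end

theory Submission
  imports Defs
begin

text \<open>
  Let \<open>x\<^sub>i = x0 + c\<^sub>i h\<close>, let \<open>e\<^sub>i = Y\<^sub>i - y(x\<^sub>i)\<close> be the stage errors and \<open>J\<close> the Jacobian of \<open>f\<close> along the
  exact solution. Then \<open>f(Y\<^sub>i) = y'(x\<^sub>i) + J(x\<^sub>i) e\<^sub>i + O(e\<^sub>i\<^sup>2)\<close>, so up to the quadratic remainder the
  errors satisfy a linear recursion driven by the quadrature defects \<open>A c\<^sup>k\<^sup>-\<^sup>1 - c\<^sup>k / k\<close>. The defect
  for \<open>k = 2\<close> vanishes except at the second stage. Hence all other stages have \<open>e\<^sub>i = O(h\<^sup>3)\<close>, and since
  \<open>b\<^sub>2 = 0\<close> and \<open>(b\<^sup>T A)\<^sub>2 = 0\<close> the quadratic remainder does not matter through order six. What remains are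
  conditions in which \<open>b\<close>, powers of \<open>c\<close>, \<open>A\<close> and the defects are multiplied. They all hold through order
  five. At order six four of them fail, but these cancel in pairs as soon as \<open>J(x)\<close> and \<open>J(x')\<close> commute,
  that is, for scalar problems. A triangular polynomial system in dimension four isolates one of the
  four and shows that the vector order is not six.
\<close>

section \<open>Differentiability on boxes\<close>

text \<open>No rooted trees or elementary differentials occur: the right-hand side enters only
  through the Taylor coefficients \<open>F_n\<close> of the exact slope and \<open>J_m\<close> of
  the Jacobian along the exact solution. An explicit dependence on \<open>x\<close> is then
  invisible, so both kinds of problem share one expansion. The obstacle is the second stage: its
  error is only \<open>O(h^2)\<close>, so its quadratic remainder is \<open>O(h^4)\<close> and is
  known only as a bound. Its direct effect on the step is removed by the zero weight. After one
  multiplication by \<open>A\<close>, the zero entry of \<open>b^T A\<close> removes the part with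
  \<open>J(x_0)\<close>, and the variation of \<open>J\<close> supplies the missing power of
  \<open>h\<close>. After two multiplications the powers of \<open>h\<close> suffice by themselves.
  With \<open>s = 1/4140 + sqrt 415 / 27600\<close>, what survives at order six is
  \<open>s (J_0 J_1 - J_1 J_0) (F_2 + 3/2 J_0 F_1)\<close>. The counterexample is built so that
  \<open>F_1 = 0\<close>, \<open>J_0 J_1 F_2 = 0\<close> and \<open>J_1 J_0 F_2\<close> is a unit
  vector, which leaves the error \<open>- s h^6\<close>.\<close>

definition box_nbhd :: "nat \<Rightarrow> (nat \<Rightarrow> real) \<Rightarrow> real \<Rightarrow> (nat \<Rightarrow> real) set" where
  "box_nbhd d z0 \<delta> = {z \<in> topspace (Euclidean_space d). \<forall>i<d. \<bar>z i - z0 i\<bar> < \<delta>}"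

text \<open>Coordinates from \<open>d\<close> on vanish at \<open>z0\<close> and at every point of
  the space, so a basic open set constrains only the first \<open>d\<close> of them and a minimum of
  finitely many radii suffices.\<close>

lemma box_nbhd_subset_openin:
  assumes "openin (Euclidean_space d) U" "z0 \<in> U"
  obtains \<delta> where "\<delta> > 0" "box_nbhd d z0 \<delta> \<subseteq> U"
proof -
  obtain V where V: "openin (powertop_real UNIV) V" "U = V \<inter> {x. \<forall>i\<ge>d. x i = 0}"
    using assms(1) by (auto simp: Euclidean_space_def openin_subtopology)
  then obtain X where X: "z0 \<in> (\<Pi>\<^sub>E i\<in>UNIV. X i)" "\<And>i. open (X i)" "(\<Pi>\<^sub>E i\<in>UNIV. X i) \<subseteq> V"
    using product_topology_open_contains_basis[OF V(1), of z0] assms(2) by auto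
  have "\<exists>e>0. \<forall>t. \<bar>t - z0 i\<bar> < e \<longrightarrow> t \<in> X i" for i
  proof -
    have "z0 i \<in> X i" using X(1) by auto
    with X(2)[of i] obtain e where "e > 0" "\<forall>t. dist t (z0 i) < e \<longrightarrow> t \<in> X i"
      unfolding open_dist by blast
    then show ?thesis by (auto simp: dist_real_def)
  qed
  then obtain e where e: "\<And>i. e i > 0" "\<And>i t. \<bar>t - z0 i\<bar> < e i \<Longrightarrow> t \<in> X i"
    by metis
  \<comment> \<open>The inserted 1 keeps the minimum meaningful for \<open>d = 0\<close>.\<close>
  define \<delta> where "\<delta> = Min (insert 1 (e ` {..<d}))"
  have \<delta>: "\<delta> > 0" "\<And>i. i < d \<Longrightarrow> \<delta> \<le> e i"
    using e(1) by (auto simp: \<delta>_def)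
  have "z \<in> U" if z: "z \<in> box_nbhd d z0 \<delta>" for z
  proof -
    have "z i \<in> X i" for i
    proof (cases "i < d")
      case True
      then show ?thesis using z \<delta>(2)[of i] e(2) by (force simp: box_nbhd_def)
    next
      case False
      then have "z i = z0 i"
        using z assms(2) V(2) by (auto simp: box_nbhd_def topspace_Euclidean_space)
      then show ?thesis using X(1) by auto
    qed
    then show ?thesis
      using z X(3) V(2) by (auto simp: box_nbhd_def topspace_Euclidean_space)
  qed
  then show ?thesis using that \<delta>(1) by blast
qed

lemma box_nbhd_mono: "\<delta> \<le> \<epsilon> \<Longrightarrow> box_nbhd d z0 \<delta> \<subseteq> box_nbhd d z0 \<epsilon>"
  by (force simp: box_nbhd_def)

lemma continuous_map_box_nbhd:
  assumes "openin (Euclidean_space d) U" "z0 \<in> U"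
    and "continuous_map (subtopology (Euclidean_space d) U) euclideanreal g" and "e > 0"
  obtains \<delta> where "\<delta> > 0" "box_nbhd d z0 \<delta> \<subseteq> U"
    "\<And>z. z \<in> box_nbhd d z0 \<delta> \<Longrightarrow> \<bar>g z - g z0\<bar> < e"
proof -
  let ?W = "{z \<in> topspace (subtopology (Euclidean_space d) U). g z \<in> ball (g z0) e}"
  have "openin (subtopology (Euclidean_space d) U) ?W"
    using assms(3) by (intro openin_continuous_map_preimage) auto
  then have W: "openin (Euclidean_space d) ?W"
    using assms(1) by (simp add: openin_open_subtopology)
  have "z0 \<in> ?W"
    using assms openin_subset by fastforce
  from box_nbhd_subset_openin[OF W this]
  obtain \<delta> where \<delta>: "\<delta> > 0" "box_nbhd d z0 \<delta> \<subseteq> ?W" by blast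
  show ?thesis
  proof (rule that[OF \<delta>(1)])
    show "box_nbhd d z0 \<delta> \<subseteq> U" using \<delta>(2) by auto
    show "\<bar>g z - g z0\<bar> < e" if "z \<in> box_nbhd d z0 \<delta>" for z
      using \<delta>(2) that by (auto simp: dist_real_def)
  qed
qed

lemma Ck_on_imp_continuous: "Ck_on d k U g \<Longrightarrow>
    continuous_map (subtopology (Euclidean_space d) U) euclideanreal g"
  by (cases k) auto

lemma Ck_on_SucD: "Ck_on d (Suc k) U g \<Longrightarrow> Ck_on d k U g"
proof (induction k arbitrary: g)
  case (Suc k)
  from Suc.prems have "\<forall>i<d. \<exists>g'. (\<forall>z\<in>U. ((\<lambda>t. g (z(i := t))) has_real_derivative g' z) (at (z i))) \<and>
      Ck_on d (Suc k) U g'" "continuous_map (subtopology (Euclidean_space d) U) euclideanreal g"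
    by (auto simp only: Ck_on.simps(2)[of d "Suc k"])
  then show ?case
    by (subst Ck_on.simps(2)) (use Suc.IH in meson)
qed simp

lemma Ck_on_mono: "Ck_on d k U g \<Longrightarrow> j \<le> k \<Longrightarrow> Ck_on d j U g"
  by (rule inc_induct[where P = "\<lambda>j. Ck_on d j U g"]) (auto intro: Ck_on_SucD)

text \<open>Collects the partial derivatives, which \<open>Ck_on\<close> asserts index by index,
  into one family that can serve as a gradient and as a row of the Jacobian.\<close>

definition has_partials :: "nat \<Rightarrow> (nat \<Rightarrow> real) set \<Rightarrow> ((nat \<Rightarrow> real) \<Rightarrow> real)
    \<Rightarrow> (nat \<Rightarrow> (nat \<Rightarrow> real) \<Rightarrow> real) \<Rightarrow> bool" where
  "has_partials d U g g' \<longleftrightarrow>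
     (\<forall>i<d. \<forall>z\<in>U. ((\<lambda>t. g (z(i := t))) has_real_derivative g' i z) (at (z i)))"

lemma Ck_on_Suc_partials:
  assumes "Ck_on d (Suc k) U g"
  obtains g' where "has_partials d U g g'" "\<And>i. i < d \<Longrightarrow> Ck_on d k U (g' i)"
  using assms unfolding Ck_on.simps has_partials_def by metis

text \<open>Change one coordinate at a time and apply the mean value theorem to each change.\<close>

lemma mean_value_box:
  assumes g': "has_partials d U g g'" and B: "box_nbhd d z0 \<delta> \<subseteq> U"
    and z: "z \<in> box_nbhd d z0 \<delta>" and w: "w \<in> box_nbhd d z0 \<delta>"
  obtains \<xi> where "\<And>l. l < d \<Longrightarrow> \<xi> l \<in> box_nbhd d z0 \<delta>"
    "\<And>l i. l < d \<Longrightarrow> \<bar>\<xi> l i - z i\<bar> \<le> \<bar>w i - z i\<bar>"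
    "g w - g z = (\<Sum>l<d. g' l (\<xi> l) * (w l - z l))"
proof -
  define p where "p m = (\<lambda>i. if i < m then w i else z i)" for m
  have upd: "(p m)(m := t) \<in> box_nbhd d z0 \<delta> \<and> (\<forall>i. \<bar>((p m)(m := t)) i - z i\<bar> \<le> \<bar>w i - z i\<bar>)"
    if "m < d" "min (z m) (w m) \<le> t" "t \<le> max (z m) (w m)" for m t
  proof -
    have "\<bar>z m - z0 m\<bar> < \<delta>" "\<bar>w m - z0 m\<bar> < \<delta>"
      using z w that(1) by (auto simp: box_nbhd_def)
    then have "\<bar>t - z0 m\<bar> < \<delta>" "\<bar>t - z m\<bar> \<le> \<bar>w m - z m\<bar>"
      using that(2,3) by (auto simp: min_def max_def split: if_splits)
    then show ?thesis
      using that(1) z w by (auto simp: box_nbhd_def p_def topspace_Euclidean_space)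
  qed
  have "\<exists>x. x \<in> box_nbhd d z0 \<delta> \<and> (\<forall>i. \<bar>x i - z i\<bar> \<le> \<bar>w i - z i\<bar>) \<and>
            g (p (Suc m)) - g (p m) = g' m x * (w m - z m)" if m: "m < d" for m
  proof -
    let ?\<phi> = "\<lambda>t. g ((p m)(m := t))"
    have der: "(?\<phi> has_real_derivative g' m ((p m)(m := t))) (at t)"
      if "min (z m) (w m) \<le> t" "t \<le> max (z m) (w m)" for t
    proof -
      have "(p m)(m := t) \<in> U" using B upd[OF m that] by blast
      then have "((\<lambda>s. g (((p m)(m := t))(m := s))) has_real_derivative g' m ((p m)(m := t)))
          (at (((p m)(m := t)) m))"
        using g' m unfolding has_partials_def by blast
      then show ?thesis by simp
    qed
    have e: "p (Suc m) = (p m)(m := w m)" "p m = (p m)(m := z m)"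
      by (auto simp: p_def)
    have "\<exists>t. min (z m) (w m) \<le> t \<and> t \<le> max (z m) (w m) \<and>
        ?\<phi> (w m) - ?\<phi> (z m) = g' m ((p m)(m := t)) * (w m - z m)"
    proof (cases "z m" "w m" rule: linorder_cases)
      case less
      then show ?thesis
        using MVT2[of "z m" "w m" ?\<phi> "\<lambda>t. g' m ((p m)(m := t))"] der
        by (metis less_eq_real_def max.absorb2 min.absorb1 mult.commute)
    next
      case equal
      then show ?thesis by auto
    next
      case greater
      then obtain t where "w m < t" "t < z m"
        "?\<phi> (z m) - ?\<phi> (w m) = (z m - w m) * g' m ((p m)(m := t))"
        using MVT2[of "w m" "z m" ?\<phi> "\<lambda>t. g' m ((p m)(m := t))"] der by fastforce
      then show ?thesis using greater
        by (intro exI[of _ t]) (auto simp: algebra_simps)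
    qed
    then show ?thesis using upd[OF m] e by metis
  qed
  then obtain \<xi> where \<xi>: "\<And>m. m < d \<Longrightarrow> \<xi> m \<in> box_nbhd d z0 \<delta>"
    "\<And>m i. m < d \<Longrightarrow> \<bar>\<xi> m i - z i\<bar> \<le> \<bar>w i - z i\<bar>"
    "\<And>m. m < d \<Longrightarrow> g (p (Suc m)) - g (p m) = g' m (\<xi> m) * (w m - z m)"
    by metis
  have "p d = w" "p 0 = z"
    using z w by (auto simp: p_def fun_eq_iff box_nbhd_def topspace_Euclidean_space)
  then have "g w - g z = (\<Sum>m<d. g (p (Suc m)) - g (p m))"
    using sum_lessThan_telescope[of "\<lambda>m. g (p m)" d] by simp
  also have "\<dots> = (\<Sum>l<d. g' l (\<xi> l) * (w l - z l))"
    using \<xi>(3) by (intro sum.cong) auto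
  finally show ?thesis using that \<xi> by blast
qed

text \<open>Continuous partials are bounded near the centre. The sum of the individual bounds is a
  crude common constant that also makes sense for \<open>d = 0\<close>.\<close>

lemma Lipschitz_box:
  assumes U: "openin (Euclidean_space d) U" "z0 \<in> U" and g: "Ck_on d (Suc 0) U g"
  obtains C \<delta> where "\<delta> > 0" "C \<ge> 0" "box_nbhd d z0 \<delta> \<subseteq> U"
    "\<And>z w. z \<in> box_nbhd d z0 \<delta> \<Longrightarrow> w \<in> box_nbhd d z0 \<delta> \<Longrightarrow>
       \<bar>g w - g z\<bar> \<le> C * (\<Sum>l<d. \<bar>w l - z l\<bar>)"
proof -
  obtain g' where g': "has_partials d U g g'" "\<And>i. i < d \<Longrightarrow> Ck_on d 0 U (g' i)"
    using Ck_on_Suc_partials[OF g] by blast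
  have "\<exists>\<delta>>0. box_nbhd d z0 \<delta> \<subseteq> U \<and> (\<forall>z\<in>box_nbhd d z0 \<delta>. \<bar>g' i z - g' i z0\<bar> < 1)" if "i < d" for i
    using continuous_map_box_nbhd[OF U Ck_on_imp_continuous[OF g'(2)[OF that]], of 1]
    by (metis zero_less_one)
  then obtain \<delta>f where \<delta>f: "\<And>i. i < d \<Longrightarrow> \<delta>f i > 0"
    "\<And>i z. i < d \<Longrightarrow> z \<in> box_nbhd d z0 (\<delta>f i) \<Longrightarrow> \<bar>g' i z - g' i z0\<bar> < 1" by metis
  obtain \<delta>0 where \<delta>0: "\<delta>0 > 0" "box_nbhd d z0 \<delta>0 \<subseteq> U" using box_nbhd_subset_openin[OF U] .
  define \<delta> where "\<delta> = Min (insert \<delta>0 (\<delta>f ` {..<d}))"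
  define C where "C = (\<Sum>l<d. \<bar>g' l z0\<bar> + 1)"
  have \<delta>: "\<delta> > 0" "\<delta> \<le> \<delta>0" "\<And>i. i < d \<Longrightarrow> \<delta> \<le> \<delta>f i"
    using \<delta>f(1) \<delta>0(1) by (auto simp: \<delta>_def)
  have sub: "box_nbhd d z0 \<delta> \<subseteq> U" using box_nbhd_mono[OF \<delta>(2)] \<delta>0(2) by blast
  have bd: "\<bar>g' l z\<bar> \<le> C" if "l < d" "z \<in> box_nbhd d z0 \<delta>" for l z
  proof -
    have "\<bar>g' l z\<bar> \<le> \<bar>g' l z0\<bar> + 1"
      using \<delta>f(2)[OF that(1), of z] box_nbhd_mono[OF \<delta>(3)[OF that(1)]] that(2) by force
    also have "\<dots> \<le> C" unfolding C_def using that(1) by (intro member_le_sum) auto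
    finally show ?thesis .
  qed
  have C0: "C \<ge> 0" by (auto simp: C_def intro!: sum_nonneg)
  have "\<bar>g w - g z\<bar> \<le> C * (\<Sum>l<d. \<bar>w l - z l\<bar>)"
    if z: "z \<in> box_nbhd d z0 \<delta>" "w \<in> box_nbhd d z0 \<delta>" for z w
  proof -
    obtain \<xi> where \<xi>: "\<And>l. l < d \<Longrightarrow> \<xi> l \<in> box_nbhd d z0 \<delta>"
      "g w - g z = (\<Sum>l<d. g' l (\<xi> l) * (w l - z l))"
      using mean_value_box[OF g'(1) sub z] by metis
    have "\<bar>g w - g z\<bar> \<le> (\<Sum>l<d. \<bar>g' l (\<xi> l) * (w l - z l)\<bar>)"
      unfolding \<xi>(2) by (rule sum_abs)
    also have "\<dots> \<le> (\<Sum>l<d. C * \<bar>w l - z l\<bar>)"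
      unfolding abs_mult using bd \<xi>(1) by (intro sum_mono mult_right_mono) auto
    finally show ?thesis by (simp add: sum_distrib_left)
  qed
  then show ?thesis using that \<delta>(1) sub C0 by blast
qed

text \<open>The intermediate points of the mean value formula are as close to \<open>z\<close> as
  \<open>w\<close> is, so a Lipschitz gradient costs one more factor of the distance. The base point
  \<open>z\<close> varies over the box because it will move along the exact solution.\<close>

lemma quadratic_remainder_box:
  assumes U: "openin (Euclidean_space d) U" "z0 \<in> U"
    and g': "has_partials d U g g'" "\<And>i. i < d \<Longrightarrow> Ck_on d (Suc 0) U (g' i)"
  obtains C \<delta> where "\<delta> > 0" "C \<ge> 0" "box_nbhd d z0 \<delta> \<subseteq> U"
    "\<forall>z\<in>box_nbhd d z0 \<delta>. \<forall>w\<in>box_nbhd d z0 \<delta>.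
       \<bar>g w - g z - (\<Sum>l<d. g' l z * (w l - z l))\<bar> \<le> C * (\<Sum>l<d. \<bar>w l - z l\<bar>)\<^sup>2"
proof -
  have "\<forall>i. \<exists>\<delta> C. i < d \<longrightarrow> \<delta> > 0 \<and> C \<ge> 0 \<and> (\<forall>z\<in>box_nbhd d z0 \<delta>. \<forall>w\<in>box_nbhd d z0 \<delta>.
      \<bar>g' i w - g' i z\<bar> \<le> C * (\<Sum>l<d. \<bar>w l - z l\<bar>))"
  proof
    fix i
    show "\<exists>\<delta> C. i < d \<longrightarrow> \<delta> > 0 \<and> C \<ge> 0 \<and> (\<forall>z\<in>box_nbhd d z0 \<delta>. \<forall>w\<in>box_nbhd d z0 \<delta>.
      \<bar>g' i w - g' i z\<bar> \<le> C * (\<Sum>l<d. \<bar>w l - z l\<bar>))"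
    proof (cases "i < d")
      case True
      from Lipschitz_box[OF U g'(2)[OF True]] show ?thesis by metis
    qed auto
  qed
  from choice[OF this] obtain \<delta>f where "\<forall>i. \<exists>C. i < d \<longrightarrow> \<delta>f i > 0 \<and> C \<ge> 0 \<and>
      (\<forall>z\<in>box_nbhd d z0 (\<delta>f i). \<forall>w\<in>box_nbhd d z0 (\<delta>f i).
        \<bar>g' i w - g' i z\<bar> \<le> C * (\<Sum>l<d. \<bar>w l - z l\<bar>))" by blast
  from choice[OF this] obtain Cf where f: "\<And>i. i < d \<Longrightarrow> \<delta>f i > 0" "\<And>i. i < d \<Longrightarrow> Cf i \<ge> 0"
    "\<And>i z w. i < d \<Longrightarrow> z \<in> box_nbhd d z0 (\<delta>f i) \<Longrightarrow> w \<in> box_nbhd d z0 (\<delta>f i) \<Longrightarrow>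
        \<bar>g' i w - g' i z\<bar> \<le> Cf i * (\<Sum>l<d. \<bar>w l - z l\<bar>)" by blast
  obtain \<delta>0 where \<delta>0: "\<delta>0 > 0" "box_nbhd d z0 \<delta>0 \<subseteq> U" using box_nbhd_subset_openin[OF U] .
  define \<delta> where "\<delta> = Min (insert \<delta>0 (\<delta>f ` {..<d}))"
  define C where "C = (\<Sum>l<d. Cf l)"
  have \<delta>: "\<delta> > 0" "\<delta> \<le> \<delta>0" "\<And>i. i < d \<Longrightarrow> \<delta> \<le> \<delta>f i"
    using f(1) \<delta>0(1) by (auto simp: \<delta>_def)
  have C: "\<And>i. i < d \<Longrightarrow> Cf i \<le> C" "C \<ge> 0"
    using f(2) by (auto simp: C_def intro!: member_le_sum sum_nonneg)
  have sub: "box_nbhd d z0 \<delta> \<subseteq> U" using box_nbhd_mono[OF \<delta>(2)] \<delta>0(2) by blast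
  have "\<bar>g w - g z - (\<Sum>l<d. g' l z * (w l - z l))\<bar> \<le> C * (\<Sum>l<d. \<bar>w l - z l\<bar>)\<^sup>2"
    if z: "z \<in> box_nbhd d z0 \<delta>" "w \<in> box_nbhd d z0 \<delta>" for z w
  proof -
    let ?D = "\<Sum>l<d. \<bar>w l - z l\<bar>"
    obtain \<xi> where \<xi>: "\<And>l. l < d \<Longrightarrow> \<xi> l \<in> box_nbhd d z0 \<delta>"
      "\<And>l i. l < d \<Longrightarrow> \<bar>\<xi> l i - z i\<bar> \<le> \<bar>w i - z i\<bar>"
      "g w - g z = (\<Sum>l<d. g' l (\<xi> l) * (w l - z l))"
      using mean_value_box[OF g'(1) sub z] by metis
    have D: "\<bar>g' l (\<xi> l) - g' l z\<bar> \<le> C * ?D" if l: "l < d" for l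
    proof -
      have "\<bar>g' l (\<xi> l) - g' l z\<bar> \<le> Cf l * (\<Sum>i<d. \<bar>\<xi> l i - z i\<bar>)"
        using f(3)[OF l] \<xi>(1)[OF l] z(1) box_nbhd_mono[OF \<delta>(3)[OF l]] by blast
      also have "\<dots> \<le> C * ?D"
        using C l \<xi>(2)[OF l] by (intro mult_mono sum_mono sum_nonneg) auto
      finally show ?thesis .
    qed
    have "g w - g z - (\<Sum>l<d. g' l z * (w l - z l)) = (\<Sum>l<d. (g' l (\<xi> l) - g' l z) * (w l - z l))"
      unfolding \<xi>(3) by (simp add: sum_subtractf left_diff_distrib)
    also have "\<bar>\<dots>\<bar> \<le> (\<Sum>l<d. \<bar>(g' l (\<xi> l) - g' l z) * (w l - z l)\<bar>)"
      by (rule sum_abs)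
    also have "\<dots> \<le> (\<Sum>l<d. (C * ?D) * \<bar>w l - z l\<bar>)"
      unfolding abs_mult using D by (intro sum_mono mult_right_mono) auto
    also have "\<dots> = C * ?D\<^sup>2"
      by (simp add: power2_eq_square sum_distrib_left[symmetric] mult.assoc)
    finally show ?thesis .
  qed
  then show ?thesis using that \<delta>(1) sub C(2) by blast
qed

section \<open>Taylor expansions at zero\<close>

text \<open>The filter is \<open>nhds 0\<close> rather than \<open>at 0\<close>, so that \<open>h\<close> may be replaced by \<open>c h\<close> even when \<open>c = 0\<close>.\<close>

definition taylor :: "nat \<Rightarrow> (real \<Rightarrow> real) \<Rightarrow> (nat \<Rightarrow> real) \<Rightarrow> bool" where
  "taylor N u a \<longleftrightarrow> (\<lambda>h. u h - (\<Sum>n<N. a n * h ^ n)) \<in> O[nhds 0](\<lambda>h. h ^ N)"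

lemma bigo_power_mono:
  assumes "f \<in> O[nhds 0](\<lambda>h::real. h ^ N)" "M \<le> N"
  shows "f \<in> O[nhds 0](\<lambda>h. h ^ M :: real)"
proof -
  have "eventually (\<lambda>h::real. \<bar>h\<bar> < 1) (nhds 0)"
    using eventually_nhds_in_open[of "{-1<..<1::real}" 0] by (auto elim!: eventually_mono)
  then have "(\<lambda>h::real. h ^ N) \<in> O[nhds 0](\<lambda>h. h ^ M)"
    using assms(2) by (intro bigoI[of _ 1], elim eventually_mono) (auto simp: power_abs power_decreasing)
  with assms(1) show ?thesis by (rule landau_o.big_trans)
qed

lemma bigo_cmult: "f \<in> O[F](g) \<Longrightarrow> (\<lambda>x. c * f x :: real) \<in> O[F](g)"
  by (cases "c = 0") simp_all

lemma power_bigo_power: "M \<le> N \<Longrightarrow> (\<lambda>h::real. h ^ N) \<in> O[nhds 0](\<lambda>h. h ^ M)"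
  by (rule bigo_power_mono) simp_all

lemma bigo_power_mult:
  fixes f g :: "real \<Rightarrow> real"
  assumes "f \<in> O[nhds 0](\<lambda>h. h ^ M)" "g \<in> O[nhds 0](\<lambda>h. h ^ N)"
  shows "(\<lambda>h. f h * g h) \<in> O[nhds 0](\<lambda>h. h ^ (M + N))"
  using landau_o.big.mult[OF assms] by (simp add: power_add)

lemma bigo_id_mult:
  fixes f :: "real \<Rightarrow> real"
  assumes "f \<in> O[nhds 0](\<lambda>h. h ^ N)"
  shows "(\<lambda>h. h * f h) \<in> O[nhds 0](\<lambda>h. h ^ Suc N)"
  using landau_o.big.mult[OF landau_o.big_refl assms, of "\<lambda>h. h"] by simp

lemma bigo_power_scale:
  fixes f :: "real \<Rightarrow> real"
  assumes "f \<in> O[nhds 0](\<lambda>h. h ^ N)"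
  shows "(\<lambda>h. f (c * h)) \<in> O[nhds 0](\<lambda>h. h ^ N)"
proof -
  have "filterlim (\<lambda>h. c * h) (nhds 0) (nhds 0)"
    by (rule tendsto_mult_right_zero[OF filterlim_ident])
  from landau_o.big.compose[OF assms this]
  have "(\<lambda>h. f (c * h)) \<in> O[nhds 0](\<lambda>h. c ^ N * h ^ N)"
    by (simp add: power_mult_distrib)
  also have "(\<lambda>h. c ^ N * h ^ N) \<in> O[nhds 0](\<lambda>h. h ^ N)"
    by (cases "c ^ N = 0") simp_all
  finally show ?thesis .
qed

lemma taylor_0: "taylor 0 u a \<longleftrightarrow> u \<in> O[nhds 0](\<lambda>_. 1)"
  by (simp add: taylor_def)

text \<open>The passage from algebra to analysis: bounds on stage errors and local errors are
  obtained by checking that leading coefficients vanish.\<close>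

lemma taylor_bigo:
  assumes "taylor N u a" "\<And>n. n < M \<Longrightarrow> a n = 0" "M \<le> N"
  shows "u \<in> O[nhds 0](\<lambda>h. h ^ M)"
proof -
  have "(\<lambda>h. u h - (\<Sum>n<N. a n * h ^ n)) \<in> O[nhds 0](\<lambda>h. h ^ M)"
    using bigo_power_mono assms unfolding taylor_def by blast
  moreover have "(\<lambda>h. \<Sum>n<N. a n * h ^ n) \<in> O[nhds 0](\<lambda>h. h ^ M)"
  proof (rule big_sum_in_bigo)
    fix n assume "n \<in> {..<N}"
    show "(\<lambda>h. a n * h ^ n) \<in> O[nhds 0](\<lambda>h. h ^ M)"
    proof (cases "n < M")
      case False
      then show ?thesis using landau_o.big.cmult_in_iff' power_bigo_power[of M n]
        by (cases "a n = 0") auto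
    qed (simp add: assms(2))
  qed
  ultimately show ?thesis using sum_in_bigo(1) by fastforce
qed

lemma taylor_mono:
  assumes "taylor N u a" "M \<le> N"
  shows "taylor M u a"
proof -
  have "taylor N (\<lambda>h. u h - (\<Sum>n<M. a n * h ^ n)) (\<lambda>n. if n < M then 0 else a n)"
  proof -
    have "(\<Sum>n<N. a n * h ^ n) = (\<Sum>n<M. a n * h ^ n)
        + (\<Sum>n<N. (if n < M then 0 else a n) * h ^ n)" for h :: real
    proof -
      have "(\<Sum>n<M. a n * h ^ n) = (\<Sum>n<N. (if n < M then a n else 0) * h ^ n)"
        using assms(2) by (intro sum.mono_neutral_cong_left) auto
      then show ?thesis
        by (auto simp flip: sum.distrib intro!: sum.cong)
    qed
    then show ?thesis using assms(1) by (simp add: taylor_def algebra_simps)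
  qed
  from taylor_bigo[OF this _ assms(2)] show ?thesis by (simp add: taylor_def)
qed

lemma taylor_add_bigo:
  assumes "taylor N u a" "v \<in> O[nhds 0](\<lambda>h. h ^ N)"
  shows "taylor N (\<lambda>h. u h + v h) a"
  using sum_in_bigo(1)[OF assms[unfolded taylor_def]] by (simp add: taylor_def algebra_simps)

lemma taylor_add:
  assumes "taylor N u a" "taylor N v b"
  shows "taylor N (\<lambda>h. u h + v h) (\<lambda>n. a n + b n)"
  using sum_in_bigo(1)[OF assms[unfolded taylor_def]]
  by (simp add: taylor_def algebra_simps sum.distrib)

lemma taylor_diff:
  assumes "taylor N u a" "taylor N v b"
  shows "taylor N (\<lambda>h. u h - v h) (\<lambda>n. a n - b n)"
  using sum_in_bigo(2)[OF assms[unfolded taylor_def]]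
  by (simp add: taylor_def algebra_simps sum_subtractf)

lemma taylor_cmult:
  assumes "taylor N u a"
  shows "taylor N (\<lambda>h. c * u h) (\<lambda>n. c * a n)"
proof (cases "c = 0")
  case False
  have "(\<lambda>h. c * (u h - (\<Sum>n<N. a n * h ^ n))) \<in> O[nhds 0](\<lambda>h. h ^ N)"
    using assms False by (simp add: taylor_def)
  then show ?thesis
    by (simp add: taylor_def right_diff_distrib sum_distrib_left mult.assoc)
qed (simp add: taylor_def)

lemma taylor_sum:
  assumes "\<And>j. j \<in> S \<Longrightarrow> taylor N (u j) (a j)"
  shows "taylor N (\<lambda>h. \<Sum>j\<in>S. u j h) (\<lambda>n. \<Sum>j\<in>S. a j n)"
  using assms
proof (induction S rule: infinite_finite_induct)
  case (insert x F)
  then show ?case using taylor_add[of N "u x" "a x"] by simp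
qed (simp_all add: taylor_def)

lemma taylor_scale:
  assumes "taylor N u a"
  shows "taylor N (\<lambda>h. u (c * h)) (\<lambda>n. a n * c ^ n)"
  using bigo_power_scale[OF assms[unfolded taylor_def], of c]
  by (simp add: taylor_def power_mult_distrib mult.assoc)

lemma taylor_mult_id:
  assumes "taylor N u a"
  shows "taylor (Suc N) (\<lambda>h. h * u h) (case_nat 0 a)"
proof -
  have "h * u h - (\<Sum>n<Suc N. (case n of 0 \<Rightarrow> 0 | Suc n \<Rightarrow> a n) * h ^ n)
      = h * (u h - (\<Sum>n<N. a n * h ^ n))" for h
    by (subst sum.lessThan_Suc_shift) (simp add: right_diff_distrib sum_distrib_left mult_ac)
  then show ?thesis
    using bigo_id_mult[OF assms[unfolded taylor_def]] by (simp add: taylor_def)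
qed

lemma taylor_mult:
  assumes "taylor N u a" "taylor N v b"
  shows "taylor N (\<lambda>h. u h * v h) (\<lambda>n. \<Sum>m\<le>n. a m * b (n - m))"
proof -
  define p where "p h = (\<Sum>n<N. a n * h ^ n)" for h :: real
  define q where "q h = (\<Sum>n<N. b n * h ^ n)" for h :: real
  have bq: "q \<in> O[nhds 0](\<lambda>h. h ^ 0)" "u \<in> O[nhds 0](\<lambda>h. h ^ 0)"
  proof -
    have "taylor N q b" by (simp add: taylor_def q_def)
    then show "q \<in> O[nhds 0](\<lambda>h. h ^ 0)" by (rule taylor_bigo) auto
    show "u \<in> O[nhds 0](\<lambda>h. h ^ 0)" using assms(1) by (rule taylor_bigo) auto
  qed
  \<comment> \<open>The difference of the products \<open>u v - p q\<close>, split so that each term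
    pairs a bounded factor with a Taylor remainder.\<close>
  have 1: "(\<lambda>h. u h * (v h - q h) + (u h - p h) * q h) \<in> O[nhds 0](\<lambda>h. h ^ N)"
    using bigo_power_mult[OF bq(2) assms(2)[unfolded taylor_def]]
      bigo_power_mult[OF assms(1)[unfolded taylor_def] bq(1)]
    by (intro sum_in_bigo(1)) (simp_all add: p_def q_def)
  define S where "S = {..<N} \<times> {..<N}"
  \<comment> \<open>The triangle \<open>L\<close> carries the Cauchy product; every monomial in the
    rest of the square has degree at least \<open>N\<close>.\<close>
  define L where "L = {(m, k). m + k < N}"
  have fin: "finite S" by (simp add: S_def)
  have LS: "L \<subseteq> S" by (auto simp: L_def S_def)
  have prod: "p h * q h = (\<Sum>(m, k)\<in>S. a m * b k * h ^ (m + k))" for h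
    by (auto simp: p_def q_def S_def sum_product sum.cartesian_product power_add intro!: sum.cong)
  have low: "(\<Sum>n<N. (\<Sum>m\<le>n. a m * b (n - m)) * h ^ n) = (\<Sum>(m, k)\<in>L. a m * b k * h ^ (m + k))"
    for h :: real
  proof -
    have "(\<Sum>n<N. (\<Sum>m\<le>n. a m * b (n - m)) * h ^ n)
        = (\<Sum>(n, m)\<in>Sigma {..<N} (\<lambda>n. {..n}). a m * b (n - m) * h ^ n)"
      by (simp add: sum_distrib_right sum.Sigma)
    also have "\<dots> = (\<Sum>(m, k)\<in>L. a m * b k * h ^ (m + k))"
      by (rule sum.reindex_bij_witness[of _ "\<lambda>(m, k). (m + k, m)" "\<lambda>(n, m). (m, n - m)"])
        (auto simp: L_def)
    finally show ?thesis .
  qed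
  have "p h * q h - (\<Sum>n<N. (\<Sum>m\<le>n. a m * b (n - m)) * h ^ n)
      = (\<Sum>(m, k)\<in>S - L. a m * b k * h ^ (m + k))" for h
    unfolding prod low by (rule sum_diff[OF fin LS, symmetric])
  moreover have "(\<lambda>h. \<Sum>(m, k)\<in>S - L. a m * b k * h ^ (m + k)) \<in> O[nhds 0](\<lambda>h. h ^ N)"
  proof -
    have "(\<lambda>h. a (fst x) * b (snd x) * h ^ (fst x + snd x)) \<in> O[nhds 0](\<lambda>h. h ^ N)"
      if "x \<in> S - L" for x
    proof -
      have "N \<le> fst x + snd x" using that by (auto simp: L_def S_def)
      from power_bigo_power[OF this] show ?thesis
        by (cases "a (fst x) * b (snd x) = 0") (auto simp: landau_o.big.cmult_in_iff)
    qed
    then show ?thesis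
      unfolding case_prod_unfold by (rule big_sum_in_bigo)
  qed
  ultimately have 2: "(\<lambda>h. p h * q h - (\<Sum>n<N. (\<Sum>m\<le>n. a m * b (n - m)) * h ^ n))
      \<in> O[nhds 0](\<lambda>h. h ^ N)" by simp
  show ?thesis
    using sum_in_bigo(1)[OF 1 2] by (simp add: taylor_def algebra_simps)
qed

text \<open>By the mean value theorem \<open>w h = h * w' z\<close> with \<open>z\<close> between 0
  and \<open>h\<close>; the factor \<open>h\<close> is the gained order.\<close>

lemma bigo_antiderivative:
  assumes der: "\<forall>\<^sub>F h in nhds 0. (w has_real_derivative w' h) (at h)" and w0: "w 0 = 0"
    and w': "w' \<in> O[nhds 0](\<lambda>h. h ^ N)"
  shows "w \<in> O[nhds 0](\<lambda>h. h ^ Suc N)"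
proof -
  obtain C where C: "C > 0" "\<forall>\<^sub>F h in nhds 0. \<bar>w' h\<bar> \<le> C * \<bar>h ^ N\<bar>"
    using w' by (elim landau_o.bigE) auto
  obtain \<delta> where \<delta>: "\<delta> > 0" "\<And>h. \<bar>h\<bar> < \<delta> \<Longrightarrow> (w has_real_derivative w' h) (at h)"
    "\<And>h. \<bar>h\<bar> < \<delta> \<Longrightarrow> \<bar>w' h\<bar> \<le> C * \<bar>h ^ N\<bar>"
    using eventually_conj[OF der C(2)] unfolding eventually_nhds_metric dist_real_def by auto
  have "\<bar>w h\<bar> \<le> C * \<bar>h ^ Suc N\<bar>" if h: "\<bar>h\<bar> < \<delta>" for h
  proof -
    have "\<exists>z. \<bar>z\<bar> \<le> \<bar>h\<bar> \<and> w h = h * w' z"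
    proof (cases h "0 :: real" rule: linorder_cases)
      case less
      then obtain z where "h < z" "z < 0" "w 0 - w h = (0 - h) * w' z"
        using MVT2[of h 0 w w'] \<delta>(2) h by fastforce
      then show ?thesis using w0 less by (intro exI[of _ z]) auto
    next
      case greater
      then obtain z where "0 < z" "z < h" "w h - w 0 = (h - 0) * w' z"
        using MVT2[of 0 h w w'] \<delta>(2) h by fastforce
      then show ?thesis using w0 greater by (intro exI[of _ z]) auto
    qed (use w0 in auto)
    then obtain z where z: "\<bar>z\<bar> \<le> \<bar>h\<bar>" "w h = h * w' z" by blast
    have "\<bar>w' z\<bar> \<le> C * \<bar>z ^ N\<bar>" using \<delta>(3)[of z] z(1) h by linarith
    also have "\<dots> \<le> C * \<bar>h ^ N\<bar>"
      using power_mono[OF z(1), of N] C(1) by (simp add: power_abs)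
    finally have "\<bar>h\<bar> * \<bar>w' z\<bar> \<le> \<bar>h\<bar> * (C * \<bar>h ^ N\<bar>)" by (rule mult_left_mono) simp
    then show ?thesis by (simp add: z(2) abs_mult mult_ac)
  qed
  then show ?thesis
    using \<delta>(1) by (intro bigoI[of _ C]) (auto simp: eventually_nhds_metric dist_real_def)
qed

lemma taylor_antiderivative:
  assumes der: "\<forall>\<^sub>F h in nhds 0. (w has_real_derivative w' h) (at h)" and w': "taylor N w' a"
  shows "taylor (Suc N) w (case_nat (w 0) (\<lambda>n. a n / real (Suc n)))"
proof -
  define q where "q h = (\<Sum>n<N. a n / real (Suc n) * h ^ Suc n)" for h
  have "(q has_real_derivative (\<Sum>n<N. a n * h ^ n)) (at h)" for h
  proof -
    have "((\<lambda>h. a n / real (Suc n) * h ^ Suc n) has_real_derivative a n * h ^ n) (at h)" for n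
      by (rule derivative_eq_intros refl)+ (simp add: field_simps del: of_nat_Suc)
    then show ?thesis unfolding q_def by (intro DERIV_sum)
  qed
  then have "\<forall>\<^sub>F h in nhds 0. ((\<lambda>h. w h - w 0 - q h) has_real_derivative
      w' h - (\<Sum>n<N. a n * h ^ n)) (at h)"
    using der by (auto elim!: eventually_mono intro!: derivative_eq_intros)
  from bigo_antiderivative[OF this _ w'[unfolded taylor_def]]
  have "(\<lambda>h. w h - w 0 - q h) \<in> O[nhds 0](\<lambda>h. h ^ Suc N)" by (simp add: q_def)
  moreover have "(\<Sum>n<Suc N. case_nat (w 0) (\<lambda>n. a n / real (Suc n)) n * h ^ n) = w 0 + q h" for h
    unfolding q_def by (subst sum.lessThan_Suc_shift) simp
  ultimately show ?thesis unfolding taylor_def by (simp only: diff_diff_eq)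
qed

section \<open>Smoothness along a curve\<close>

text \<open>Differentiability without continuity of the last derivative, which keeps the closure
  lemmas simple. Where continuity is needed, one further level is spent on it.\<close>

primrec Cn_near :: "nat \<Rightarrow> (real \<Rightarrow> real) \<Rightarrow> real \<Rightarrow> bool" where
  "Cn_near 0 u x0 \<longleftrightarrow> True"
| "Cn_near (Suc n) u x0 \<longleftrightarrow>
     (\<exists>u'. (\<forall>\<^sub>F x in nhds x0. (u has_real_derivative u' x) (at x)) \<and> Cn_near n u' x0)"

lemma Cn_near_SucI:
  "\<forall>\<^sub>F x in nhds x0. (u has_real_derivative u' x) (at x) \<Longrightarrow> Cn_near n u' x0 \<Longrightarrow> Cn_near (Suc n) u x0"
  by auto

lemma Cn_near_SucD: "Cn_near (Suc n) u x0 \<Longrightarrow> Cn_near n u x0"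
proof (induction n arbitrary: u)
  case (Suc n)
  then obtain u' where "\<forall>\<^sub>F x in nhds x0. (u has_real_derivative u' x) (at x)" "Cn_near (Suc n) u' x0"
    by (auto simp only: Cn_near.simps(2)[of "Suc n"])
  with Suc.IH show ?case by (blast intro: Cn_near_SucI)
qed simp

lemma Cn_near_const: "Cn_near n (\<lambda>_. c) x0"
proof (induction n arbitrary: c)
  case (Suc n)
  show ?case
    by (subst Cn_near.simps(2), rule exI[of _ "\<lambda>_. 0"]) (simp add: Suc)
qed simp

lemma Cn_near_add: "Cn_near n u x0 \<Longrightarrow> Cn_near n v x0 \<Longrightarrow> Cn_near n (\<lambda>x. u x + v x) x0"
proof (induction n arbitrary: u v)
  case (Suc n)
  from Suc.prems obtain u' v' where
    "\<forall>\<^sub>F x in nhds x0. (u has_real_derivative u' x) (at x)" "Cn_near n u' x0"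
    "\<forall>\<^sub>F x in nhds x0. (v has_real_derivative v' x) (at x)" "Cn_near n v' x0"
    by auto
  then show ?case
    by (subst Cn_near.simps(2), intro exI[of _ "\<lambda>x. u' x + v' x"] conjI Suc.IH)
      (auto intro: DERIV_add elim: eventually_elim2)
qed simp

lemma Cn_near_mult: "Cn_near n u x0 \<Longrightarrow> Cn_near n v x0 \<Longrightarrow> Cn_near n (\<lambda>x. u x * v x) x0"
proof (induction n arbitrary: u v)
  case (Suc n)
  from Suc.prems obtain u' v' where
    uv: "\<forall>\<^sub>F x in nhds x0. (u has_real_derivative u' x) (at x)" "Cn_near n u' x0"
    "\<forall>\<^sub>F x in nhds x0. (v has_real_derivative v' x) (at x)" "Cn_near n v' x0"
    by auto
  have "\<forall>\<^sub>F x in nhds x0. ((\<lambda>x. u x * v x) has_real_derivative u' x * v x + v' x * u x) (at x)"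
    using uv(1,3) by eventually_elim (rule DERIV_mult)
  moreover have "Cn_near n (\<lambda>x. u' x * v x + v' x * u x) x0"
    using uv(2,4) Suc.prems[THEN Cn_near_SucD] Suc.IH by (intro Cn_near_add)
  ultimately show ?case by (rule Cn_near_SucI)
qed simp

lemma Cn_near_sum: "(\<And>i. i \<in> S \<Longrightarrow> Cn_near n (u i) x0) \<Longrightarrow> Cn_near n (\<lambda>x. \<Sum>i\<in>S. u i x) x0"
  by (induction S rule: infinite_finite_induct) (simp_all add: Cn_near_const Cn_near_add)

lemma eventually_nhds_shift:
  fixes x0 :: real
  assumes "\<forall>\<^sub>F x in nhds x0. P x"
  shows "\<forall>\<^sub>F h in nhds 0. P (x0 + h)"
proof -
  have "filterlim (\<lambda>h. x0 + h) (nhds x0) (nhds 0)"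
    using tendsto_add[OF tendsto_const[of x0] filterlim_ident[of "nhds (0::real)"]] by simp
  then show ?thesis using assms by (simp add: filterlim_iff)
qed

text \<open>The expansion of the derivative is integrated. The extra level pays for the base case,
  where continuity at \<open>x0\<close> gives the boundedness that an expansion of order 0
  means.\<close>

lemma Cn_near_imp_taylor:
  assumes "Cn_near (Suc N) u x0"
  obtains a where "taylor N (\<lambda>h. u (x0 + h)) a"
  using assms
proof (induction N arbitrary: u thesis)
  case 0
  then obtain u' where "\<forall>\<^sub>F x in nhds x0. (u has_real_derivative u' x) (at x)" by auto
  then have "isCont u x0" by (meson DERIV_isCont eventually_nhds_x_imp_x)
  moreover have "((\<lambda>h. x0 + h) \<longlongrightarrow> x0) (nhds 0)"
    using tendsto_add[OF tendsto_const[of x0] filterlim_ident[of "nhds (0::real)"]] by simp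
  ultimately have "((\<lambda>h. u (x0 + h)) \<longlongrightarrow> u x0) (nhds 0)"
    by (rule isCont_tendsto_compose)
  then have "taylor 0 (\<lambda>h. u (x0 + h)) (\<lambda>_. 0)"
    unfolding taylor_0 by (intro bigoI_tendsto[where c = "u x0"]) simp_all
  then show ?case by (rule 0)
next
  case (Suc N)
  from Suc.prems(2) obtain u' where u': "\<forall>\<^sub>F x in nhds x0. (u has_real_derivative u' x) (at x)"
    "Cn_near (Suc N) u' x0" by (auto simp only: Cn_near.simps(2)[of "Suc N"])
  obtain a where a: "taylor N (\<lambda>h. u' (x0 + h)) a" using Suc.IH[OF _ u'(2)] by blast
  have "\<forall>\<^sub>F h in nhds 0. ((\<lambda>h. u (x0 + h)) has_real_derivative u' (x0 + h)) (at h)"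
    using eventually_nhds_shift[OF u'(1)] by (simp add: DERIV_shift add.commute)
  from taylor_antiderivative[OF this a] show ?case by (rule Suc.prems(1))
qed

text \<open>A chain rule read off from the quadratic remainder: divided by \<open>t - x\<close>, the
  remainder is at most a displacement, which tends to 0, times difference quotients of the curve,
  which converge.\<close>

lemma has_real_derivative_compose_box:
  assumes rem: "\<forall>w\<in>B.
      \<bar>g w - g (\<gamma> x) - (\<Sum>l<d. g' l (\<gamma> x) * (w l - \<gamma> x l))\<bar> \<le> C * (\<Sum>l<d. \<bar>w l - \<gamma> x l\<bar>)\<^sup>2"
    and B: "\<forall>\<^sub>F t in nhds x. \<gamma> t \<in> B"
    and \<gamma>': "\<And>l. l < d \<Longrightarrow> ((\<lambda>t. \<gamma> t l) has_real_derivative \<gamma>' l) (at x)"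
  shows "((\<lambda>t. g (\<gamma> t)) has_real_derivative (\<Sum>l<d. g' l (\<gamma> x) * \<gamma>' l)) (at x)"
proof -
  define R where "R t = g (\<gamma> t) - g (\<gamma> x) - (\<Sum>l<d. g' l (\<gamma> x) * (\<gamma> t l - \<gamma> x l))" for t
  define D where "D t = (\<Sum>l<d. \<bar>\<gamma> t l - \<gamma> x l\<bar>)" for t
  have R0: "R x = 0" by (simp add: R_def)
  have "((\<lambda>t. C * (D t * (\<Sum>l<d. \<bar>(\<gamma> t l - \<gamma> x l) / (t - x)\<bar>)))
      \<longlongrightarrow> C * ((\<Sum>l<d. \<bar>\<gamma> x l - \<gamma> x l\<bar>) * (\<Sum>l<d. \<bar>\<gamma>' l\<bar>))) (at x)"
    unfolding D_def using \<gamma>' DERIV_isCont[OF \<gamma>']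
    by (intro tendsto_intros tendsto_sum tendsto_rabs) (auto simp: has_field_derivative_iff isCont_def)
  then have lim: "((\<lambda>t. C * (D t * (\<Sum>l<d. \<bar>(\<gamma> t l - \<gamma> x l) / (t - x)\<bar>))) \<longlongrightarrow> 0) (at x)" by simp
  have B': "\<forall>\<^sub>F t in at x. \<gamma> t \<in> B"
    using B unfolding eventually_at_filter by (rule eventually_mono) simp
  have "\<forall>\<^sub>F t in at x. norm ((R t - R x) / (t - x)) \<le> C * (D t * (\<Sum>l<d. \<bar>(\<gamma> t l - \<gamma> x l) / (t - x)\<bar>))"
    using eventually_neq_at_within[of x] B'
  proof eventually_elim
    case (elim t)
    have "\<bar>R t\<bar> \<le> C * (D t)\<^sup>2" using bspec[OF rem elim(2)] by (simp add: R_def D_def)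
    then have "\<bar>R t\<bar> / \<bar>t - x\<bar> \<le> C * (D t)\<^sup>2 / \<bar>t - x\<bar>" by (intro divide_right_mono) auto
    also have "\<dots> = C * (D t * (\<Sum>l<d. \<bar>(\<gamma> t l - \<gamma> x l) / (t - x)\<bar>))"
      by (simp add: D_def power2_eq_square sum_divide_distrib[symmetric])
    finally show ?case by (simp add: R0)
  qed
  from Lim_null_comparison[OF this lim] have "(R has_real_derivative 0) (at x)"
    by (simp add: has_field_derivative_iff)
  moreover have "((\<lambda>t. g (\<gamma> x) + (\<Sum>l<d. g' l (\<gamma> x) * (\<gamma> t l - \<gamma> x l)))
      has_real_derivative (\<Sum>l<d. g' l (\<gamma> x) * \<gamma>' l)) (at x)"
    using \<gamma>' by (auto intro!: derivative_eq_intros DERIV_sum simp: mult.commute)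
  ultimately have "((\<lambda>t. R t + (g (\<gamma> x) + (\<Sum>l<d. g' l (\<gamma> x) * (\<gamma> t l - \<gamma> x l))))
      has_real_derivative 0 + (\<Sum>l<d. g' l (\<gamma> x) * \<gamma>' l)) (at x)"
    by (rule DERIV_add)
  then show ?thesis by (simp add: R_def)
qed

lemma eventually_in_box:
  assumes "\<forall>\<^sub>F x in Fl. W x \<in> topspace (Euclidean_space d)"
    and "\<And>i. i < d \<Longrightarrow> ((\<lambda>x. W x i) \<longlongrightarrow> z0 i) Fl" and "\<delta> > 0"
  shows "\<forall>\<^sub>F x in Fl. W x \<in> box_nbhd d z0 \<delta>"
proof -
  have "\<forall>\<^sub>F x in Fl. \<forall>i\<in>{..<d}. dist (W x i) (z0 i) < \<delta>"
    using assms(2,3) by (intro eventually_ball_finite) (auto intro: tendstoD)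
  with assms(1) show ?thesis
    by eventually_elim (auto simp: box_nbhd_def dist_real_def)
qed

lemma Cn_near_imp_tendsto:
  assumes "Cn_near (Suc n) u x0"
  shows "(u \<longlongrightarrow> u x0) (nhds x0)"
proof -
  from assms have "isCont u x0" using DERIV_isCont by (auto dest: eventually_nhds_x_imp_x)
  then show ?thesis using tendsto_at_iff_tendsto_nhds[of u x0] by (simp add: isCont_def)
qed

text \<open>\<open>g\<close> needs one level more than the composite because the chain rule rests on
  a quadratic remainder, hence on partials that are themselves \<open>C^1\<close>.\<close>

lemma Cn_near_compose:
  assumes U: "openin (Euclidean_space d) U" "\<gamma> x0 \<in> U"
    and top: "\<forall>\<^sub>F x in nhds x0. \<gamma> x \<in> topspace (Euclidean_space d)"
  shows "Ck_on d (Suc n) U g \<Longrightarrow> (\<And>i. i < d \<Longrightarrow> Cn_near n (\<lambda>x. \<gamma> x i) x0) \<Longrightarrow>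
    Cn_near n (\<lambda>x. g (\<gamma> x)) x0"
proof (induction n arbitrary: g)
  case (Suc n)
  obtain g' where g': "has_partials d U g g'" "\<And>i. i < d \<Longrightarrow> Ck_on d (Suc n) U (g' i)"
    using Ck_on_Suc_partials[OF Suc.prems(1)] by blast
  have "\<exists>u'. (\<forall>\<^sub>F x in nhds x0. ((\<lambda>x. \<gamma> x i) has_real_derivative u' x) (at x)) \<and> Cn_near n u' x0"
    if "i < d" for i
    using Suc.prems(2)[OF that] unfolding Cn_near.simps .
  then obtain \<gamma>' where \<gamma>': "\<And>i. i < d \<Longrightarrow> \<forall>\<^sub>F x in nhds x0. ((\<lambda>x. \<gamma> x i) has_real_derivative \<gamma>' i x) (at x)"
    "\<And>i. i < d \<Longrightarrow> Cn_near n (\<gamma>' i) x0" by metis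
  have g'1: "\<And>i. i < d \<Longrightarrow> Ck_on d (Suc 0) U (g' i)"
    by (rule Ck_on_mono[OF g'(2)]) simp_all
  obtain \<delta> C where \<delta>: "\<delta> > 0" and "C \<ge> 0" "box_nbhd d (\<gamma> x0) \<delta> \<subseteq> U"
    and rem: "\<forall>z\<in>box_nbhd d (\<gamma> x0) \<delta>. \<forall>w\<in>box_nbhd d (\<gamma> x0) \<delta>.
       \<bar>g w - g z - (\<Sum>l<d. g' l z * (w l - z l))\<bar> \<le> C * (\<Sum>l<d. \<bar>w l - z l\<bar>)\<^sup>2"
    by (rule quadratic_remainder_box[OF U g'(1) g'1])
  have box: "\<forall>\<^sub>F x in nhds x0. \<gamma> x \<in> box_nbhd d (\<gamma> x0) \<delta>"
    using eventually_in_box[OF top Cn_near_imp_tendsto[OF Suc.prems(2)] \<delta>] .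
  have "\<forall>\<^sub>F x in nhds x0. \<forall>i\<in>{..<d}. ((\<lambda>x. \<gamma> x i) has_real_derivative \<gamma>' i x) (at x)"
    using \<gamma>'(1) by (intro eventually_ball_finite) auto
  \<comment> \<open>The derivative is taken at points \<open>x\<close> near \<open>x0\<close>, so
    the curve must stay in the box near each such \<open>x\<close>, not only near
    \<open>x0\<close>.\<close>
  moreover have "\<forall>\<^sub>F x in nhds x0. \<forall>\<^sub>F t in nhds x. \<gamma> t \<in> box_nbhd d (\<gamma> x0) \<delta>"
    using box by (simp add: eventually_eventually)
  ultimately have "\<forall>\<^sub>F x in nhds x0. ((\<lambda>x. g (\<gamma> x)) has_real_derivative (\<Sum>l<d. g' l (\<gamma> x) * \<gamma>' l x)) (at x)"
  proof eventually_elim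
    case (elim x)
    have "\<gamma> x \<in> box_nbhd d (\<gamma> x0) \<delta>" (is ?in_box) using elim(2) by (rule eventually_nhds_x_imp_x)
    show ?case
    proof (rule has_real_derivative_compose_box)
      show "\<forall>w\<in>box_nbhd d (\<gamma> x0) \<delta>. \<bar>g w - g (\<gamma> x) - (\<Sum>l<d. g' l (\<gamma> x) * (w l - \<gamma> x l))\<bar>
          \<le> C * (\<Sum>l<d. \<bar>w l - \<gamma> x l\<bar>)\<^sup>2"
        using rem \<open>?in_box\<close> by blast
    qed (use elim in auto)
  qed
  moreover have "Cn_near n (\<lambda>x. \<Sum>l<d. g' l (\<gamma> x) * \<gamma>' l x) x0"
  proof (intro Cn_near_sum Cn_near_mult)
    fix l assume "l \<in> {..<d}"
    then show "Cn_near n (\<lambda>x. g' l (\<gamma> x)) x0" "Cn_near n (\<gamma>' l) x0"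
      using Suc.IH[OF g'(2) Cn_near_SucD[OF Suc.prems(2)]] \<gamma>'(2) by blast+
  qed
  ultimately show ?case by (rule Cn_near_SucI)
qed simp

text \<open>Bootstrapping: if \<open>y\<close> is \<open>n\<close> times differentiable, so is \<open>y' = f \<circ> y\<close>.\<close>

lemma Cn_near_solution:
  assumes U: "openin (Euclidean_space d) U" "\<gamma> x0 \<in> U"
    and top: "\<forall>\<^sub>F x in nhds x0. \<gamma> x \<in> topspace (Euclidean_space d)"
    and \<phi>: "\<And>i. i < d \<Longrightarrow> smooth_on d U (\<phi> i)"
    and der: "\<And>i. i < d \<Longrightarrow> \<forall>\<^sub>F x in nhds x0. ((\<lambda>x. \<gamma> x i) has_real_derivative \<phi> i (\<gamma> x)) (at x)"
    and "i < d"
  shows "Cn_near n (\<lambda>x. \<gamma> x i) x0"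
  using \<open>i < d\<close>
proof (induction n arbitrary: i)
  case (Suc n)
  have "Cn_near n (\<lambda>x. \<phi> i (\<gamma> x)) x0"
  proof (rule Cn_near_compose[where \<gamma> = \<gamma>, OF U top])
    show "Ck_on d (Suc n) U (\<phi> i)"
      using \<phi>[OF Suc.prems] unfolding smooth_on_def by blast
  qed (rule Suc.IH)
  with der[OF Suc.prems] show ?case by (rule Cn_near_SucI)
qed simp

section \<open>The order conditions of the method\<close>

text \<open>The vector \<open>v\<close> is left free so that one evaluation of the tableau serves
  all products with \<open>A\<close>. Entries are written as \<open>p + q * sqrt 415\<close> with
  rational \<open>p\<close> and \<open>q\<close>, which reduces later checks to rational
  arithmetic.\<close>

lemma butcher_A_rows:
  fixes v :: "nat \<Rightarrow> real"
  shows
    "(\<Sum>j<1. butcher_A 1 j * v j) = (1/2) * v 0"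
    "(\<Sum>j<2. butcher_A 2 j * v j) = (1) * v 1"
    "(\<Sum>j<3. butcher_A 3 j * v j) = (16/125) * v 0 + (13/125) * v 1 + (-4/125) * v 2"
    "(\<Sum>j<4. butcher_A 4 j * v j) = (-136/2875 + (-2/2875) * sqrt 415) * v 0 + (-638/2875
      + (-6/2875) * sqrt 415) * v 1 + (821/11500 + (7/11500) * sqrt 415) * v 2 + (55/92
      + (1/460) * sqrt 415) * v 3"
    "(\<Sum>j<5. butcher_A 5 j * v j) = (2469/40250 + (-31/40250) * sqrt 415) * v 0 + (-777/2875
      + (18/2875) * sqrt 415) * v 1 + (18979/241500 + (-163/120750) * sqrt 415) * v 2 + (179/644
      + (1/1610) * sqrt 415) * v 3 + (19/42 + (-1/210) * sqrt 415) * v 4"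
    "(\<Sum>j<6. butcher_A 6 j * v j) = (961/483 + (-6701/45885) * sqrt 415) * v 0 + (-283/437
      + (12/2185) * sqrt 415) * v 1 + (15007/18354 + (-542/15295) * sqrt 415) * v 2 + (-42285/6118
      + (1650/3059) * sqrt 415) * v 3 + (4115/399 + (-5/7) * sqrt 415) * v 4 + (-260/57
      + (20/57) * sqrt 415) * v 5"
    "(\<Sum>j<7. butcher_A 7 j * v j) = (-77534/181125 + (6878/181125) * sqrt 415) * v 0
      + (1116/2875 + (-12/2875) * sqrt 415) * v 1 + (-1072261/4950750
      + (103963/14852250) * sqrt 415) * v 2 + (3489/1610 + (-223/1610) * sqrt 415) * v 3
      + (-102/35 + (58/315) * sqrt 415) * v 4 + (82/45 + (-4/45) * sqrt 415) * v 5 + (-19/1025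
      + (38/15375) * sqrt 415) * v 6"
  by (simp_all add: butcher_A_def Let_def eval_nat_numeral lessThan_Suc nth_default_Cons field_simps)

lemma butcher_b_values:
  "butcher_b 0 = 19/288" "butcher_b (Suc 0) = 0" "butcher_b 2 = 0" "butcher_b 3 = 25/96"
  "butcher_b 4 = 25/144" "butcher_b 5 = 25/144" "butcher_b 6 = 19/288" "butcher_b 7 = 25/96"
  by (simp_all add: butcher_b_def eval_nat_numeral)

lemma butcher_c_values:
  "butcher_c 0 = 0" "butcher_c (Suc 0) = 1/2" "butcher_c 2 = 1" "butcher_c 3 = 1/5"
  "butcher_c 4 = 2/5" "butcher_c 5 = 3/5" "butcher_c 6 = 1" "butcher_c 7 = 4/5"
  by (simp_all add: butcher_c_def eval_nat_numeral)

text \<open>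
  Here \<open>defect_k\<close> is the vector \<open>A c\<^sup>k\<^sup>-\<^sup>1 - c\<^sup>k / k\<close> that measures how far the stages are from
  being quadratures of order \<open>k\<close>; the prefix \<open>A\<close> stands for multiplication by the coefficient matrix.
\<close>

definition defect_2 :: "nat \<Rightarrow> real" where
  "defect_2 = nth_default 0
     [0, -1/8, 0, 0, 0, 0, 0, 0]"

definition defect_3 :: "nat \<Rightarrow> real" where
  "defect_3 = nth_default 0
     [0, -1/24, -1/12, -13/1500, 319/17250 + (1/5750) * sqrt 415, 259/11500
       + (-3/5750) * sqrt 415, 283/5244 + (-1/2185) * sqrt 415, -93/2875 + (1/2875) * sqrt 415]"

definition defect_4 :: "nat \<Rightarrow> real" where
  "defect_4 = nth_default 0
     [0, -1/64, -1/8, -97/5000, 2417/57500 + (21/57500) * sqrt 415, 35083/805000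
       + (-349/402500) * sqrt 415, 12993/122360 + (-11/30590) * sqrt 415, -38989/603750
       + (257/603750) * sqrt 415]"

definition A_defect_2 :: "nat \<Rightarrow> real" where
  "A_defect_2 = nth_default 0
     [0, 0, -1/8, -13/1000, 319/11500 + (3/11500) * sqrt 415, 777/23000 + (-9/11500) * sqrt 415,
       283/3496 + (-3/4370) * sqrt 415, -279/5750 + (3/5750) * sqrt 415]"

definition A_defect_3 :: "nat \<Rightarrow> real" where
  "A_defect_3 = nth_default 0
     [0, 0, -1/24, -1/600, -13/6900 + (1/57500) * sqrt 415, 4987/483000
       + (-197/1207500) * sqrt 415, -7631/367080 + (-283/91770) * sqrt 415, 473/362250
       + (1591/1811250) * sqrt 415]"

definition AA_defect_2 :: "nat \<Rightarrow> real" where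
  "AA_defect_2 = nth_default 0
     [0, 0, 0, 1/250, -48/2875 + (-3/28750) * sqrt 415, -113/80500 + (59/402500) * sqrt 415,
       -1096/15295 + (-131/30590) * sqrt 415, 1583/60375 + (319/301875) * sqrt 415]"

definition b_A :: "nat \<Rightarrow> real" where
  "b_A = nth_default 0
     [1/18, 0, 5/328 + (-19/29520) * sqrt 415, 25/96, 0, 25/144, -19/3936 + (19/29520) * sqrt 415,
       0]"

lemmas defect_defs = defect_2_def defect_3_def defect_4_def A_defect_2_def A_defect_3_def AA_defect_2_def

lemma sqrt_415_mult: "sqrt 415 * sqrt 415 = 415" "sqrt 415 * (sqrt 415 * x) = 415 * x"
  by (simp_all flip: mult.assoc)

lemma less_8_cases:
  assumes "i < (8::nat)"
  obtains "i = 0" | "i = 1" | "i = 2" | "i = 3" | "i = 4" | "i = 5" | "i = 6" | "i = 7"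
  using assms by linarith

lemma sum_less_8: "(\<Sum>i<8::nat. v i) = v 0 + v 1 + v 2 + v 3 + v 4 + v 5 + v 6 + (v 7 :: real)"
  by (simp add: eval_nat_numeral)

lemma butcher_row_sum: "i < 8 \<Longrightarrow> (\<Sum>j<i. butcher_A i j) = butcher_c i"
  by (elim less_8_cases)
    (simp only: butcher_A_rows[of "\<lambda>_. 1", unfolded mult_1_right] lessThan_0 sum.empty;
     simp add: butcher_c_values field_simps)+

lemma butcher_defect_2:
  "i < 8 \<Longrightarrow> (\<Sum>j<i. butcher_A i j * butcher_c j ^ 1) - butcher_c i ^ 2 / 2 = defect_2 i"
  by (elim less_8_cases)
    (simp only: butcher_A_rows lessThan_0 sum.empty;
     simp add: butcher_c_values defect_2_def nth_default_def field_simps)+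

lemma butcher_defect_3:
  "i < 8 \<Longrightarrow> (\<Sum>j<i. butcher_A i j * butcher_c j ^ 2) - butcher_c i ^ 3 / 3 = defect_3 i"
  by (elim less_8_cases)
    (simp only: butcher_A_rows lessThan_0 sum.empty;
     simp add: butcher_c_values defect_3_def nth_default_def field_simps)+

lemma butcher_defect_4:
  "i < 8 \<Longrightarrow> (\<Sum>j<i. butcher_A i j * butcher_c j ^ 3) - butcher_c i ^ 4 / 4 = defect_4 i"
  by (elim less_8_cases)
    (simp only: butcher_A_rows lessThan_0 sum.empty;
     simp add: butcher_c_values defect_4_def nth_default_def field_simps)+

lemma butcher_A_defect_2:
  "i < 8 \<Longrightarrow> (\<Sum>j<i. butcher_A i j * defect_2 j) = A_defect_2 i"
  by (elim less_8_cases)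
    (simp only: butcher_A_rows lessThan_0 sum.empty;
     simp add: defect_2_def A_defect_2_def nth_default_def field_simps sqrt_415_mult)+

lemma butcher_A_defect_3:
  "i < 8 \<Longrightarrow> (\<Sum>j<i. butcher_A i j * defect_3 j) = A_defect_3 i"
  by (elim less_8_cases)
    (simp only: butcher_A_rows lessThan_0 sum.empty;
     simp add: defect_3_def A_defect_3_def nth_default_def field_simps sqrt_415_mult)+

lemma butcher_AA_defect_2:
  "i < 8 \<Longrightarrow> (\<Sum>j<i. butcher_A i j * A_defect_2 j) = AA_defect_2 i"
  by (elim less_8_cases)
    (simp only: butcher_A_rows lessThan_0 sum.empty;
     simp add: A_defect_2_def AA_defect_2_def nth_default_def field_simps sqrt_415_mult)+

text \<open>The only nonzero entry of \<open>defect_2\<close> sits at the stage with abscissa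
  \<open>1/2\<close>. This is the origin of the factor \<open>1/2\<close> in the fourth error
  coefficient.\<close>

lemma c_defect_2: "butcher_c j * defect_2 j = 1/2 * defect_2 j"
  by (auto simp: defect_2_def butcher_c_def nth_default_Cons split: nat.split)

section \<open>Quadrature and orthogonality relations of the weights\<close>

lemma butcher_b_A:
  "(\<Sum>i<8. butcher_b i * (\<Sum>j<i. butcher_A i j * v j)) = (\<Sum>j<8. b_A j * v j)"
  unfolding sum_less_8 butcher_A_rows
  by (simp add: butcher_b_values b_A_def nth_default_def field_simps)

text \<open>The nonzero weights with their abscissae \<open>0, 1/5, ..., 1\<close> form the closed
  six-point Newton-Cotes rule, which is exact through degree five.\<close>

lemma butcher_quadrature:
  "n < 6 \<Longrightarrow> (\<Sum>i<8. butcher_b i * butcher_c i ^ n) = 1 / real (Suc n)"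
proof -
  assume "n < 6"
  then consider "n = 0" | "n = 1" | "n = 2" | "n = 3" | "n = 4" | "n = 5" by linarith
  then show ?thesis
    by cases (simp_all add: sum_less_8 butcher_b_values butcher_c_values power_divide)
qed

text \<open>The powers \<open>^ 0\<close> and \<open>^ 1\<close> are kept so that the sums match the
  weighted error coefficients literally. For \<open>A_defect_3\<close> and
  \<open>AA_defect_2\<close> the list stops at \<open>^ 0\<close>, since their sums with
  \<open>^ 1\<close> do not vanish.\<close>

lemma butcher_b_orthogonal:
  "(\<Sum>i<8. butcher_b i * (butcher_c i ^ 0 * defect_2 i)) = 0" "(\<Sum>i<8. butcher_b i * (butcher_c i ^ 1 * defect_2 i)) = 0" "(\<Sum>i<8. butcher_b i * (butcher_c i ^ 2 * defect_2 i)) = 0" "(\<Sum>i<8. butcher_b i * (butcher_c i ^ 3 * defect_2 i)) = 0"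
  "(\<Sum>i<8. butcher_b i * (butcher_c i ^ 0 * defect_3 i)) = 0" "(\<Sum>i<8. butcher_b i * (butcher_c i ^ 1 * defect_3 i)) = 0" "(\<Sum>i<8. butcher_b i * (butcher_c i ^ 2 * defect_3 i)) = 0"
  "(\<Sum>i<8. butcher_b i * (butcher_c i ^ 0 * defect_4 i)) = 0" "(\<Sum>i<8. butcher_b i * (butcher_c i ^ 1 * defect_4 i)) = 0"
  "(\<Sum>i<8. butcher_b i * (butcher_c i ^ 0 * A_defect_2 i)) = 0" "(\<Sum>i<8. butcher_b i * (butcher_c i ^ 1 * A_defect_2 i)) = 0" "(\<Sum>i<8. butcher_b i * (butcher_c i ^ 2 * A_defect_2 i)) = 0"
  "(\<Sum>i<8. butcher_b i * (butcher_c i ^ 0 * A_defect_3 i)) = 0"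
  "(\<Sum>i<8. butcher_b i * (butcher_c i ^ 0 * AA_defect_2 i)) = 0"
  by (simp_all add: sum_less_8 butcher_b_values butcher_c_values defect_defs nth_default_def
      power_divide field_simps)

text \<open>The value \<open>1/30\<close> equals one fifth of the quadrature sum of
  \<open>c ^ 5\<close>, so \<open>b\<close> is orthogonal to the fifth defect too.\<close>

lemma butcher_b_A_orthogonal:
  "b_A 1 = 0" "(\<Sum>i<8. b_A i * butcher_c i ^ 4) = 1/30"
  "(\<Sum>i<8. b_A i * defect_3 i) = 0"
  "(\<Sum>i<8. b_A i * defect_4 i) = 0"
  "(\<Sum>i<8. b_A i * A_defect_2 i) = 0"
  "(\<Sum>i<8. b_A i * A_defect_3 i) = 0"
  "(\<Sum>i<8. b_A i * AA_defect_2 i) = 0"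
  by (simp_all add: sum_less_8 b_A_def butcher_c_values defect_defs nth_default_def
      power_divide field_simps sqrt_415_mult)

text \<open>
  The two pairs of conditions of order six that fail separately and hold only in sum. In each pair
  the two trees differ by the order of two factors that commute for scalar problems.
\<close>

lemma butcher_paired_conditions:
  "(\<Sum>i<8. b_A i * (butcher_c i * defect_3 i)) = 1/4140 + 1/27600 * sqrt 415"
  "(\<Sum>i<8. butcher_b i * (butcher_c i * A_defect_3 i)) = - (1/4140 + 1/27600 * sqrt 415)"
  "(\<Sum>i<8. b_A i * (butcher_c i * A_defect_2 i)) = 1/2760 + 1/18400 * sqrt 415"
  "(\<Sum>i<8. butcher_b i * (butcher_c i * AA_defect_2 i)) = - (1/2760 + 1/18400 * sqrt 415)"
  by (simp_all add: sum_less_8 b_A_def butcher_b_values butcher_c_values defect_defs nth_default_def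
      power_divide field_simps sqrt_415_mult)

section \<open>Expansion of the error\<close>

text \<open>
  The coefficient of \<open>h\<^sup>n\<close> in component \<open>k\<close> of the error of stage \<open>i\<close>, where \<open>F k\<close> and \<open>J k l\<close> are the
  Taylor coefficients of \<open>y'\<^sub>k\<close> and of the Jacobian along the exact solution (factorials included).
\<close>

fun err_coeff :: "nat \<Rightarrow> (nat \<Rightarrow> nat \<Rightarrow> real) \<Rightarrow> (nat \<Rightarrow> real) \<Rightarrow> (nat \<Rightarrow> nat \<Rightarrow> real) \<Rightarrow>
    (nat \<Rightarrow> nat \<Rightarrow> nat \<Rightarrow> real) \<Rightarrow> nat \<Rightarrow> nat \<Rightarrow> nat \<Rightarrow> real" where
  "err_coeff d A c F J 0 i k = 0"
| "err_coeff d A c F J (Suc n) i k =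
     F k n * ((\<Sum>j<i. A i j * c j ^ n) - c i ^ Suc n / real (Suc n)) +
     (\<Sum>j<i. A i j * (\<Sum>l<d. \<Sum>m\<le>n. J k l m * c j ^ m * err_coeff d A c F J (n - m) j l))"

declare err_coeff.simps(2) [simp del]

text \<open>Explicitness permits strong induction over the stages. The perturbation \<open>R\<close>
  is a parameter because the recursion is used twice: for \<open>e\<close>, with the weighted
  nonlinear remainder, and for \<open>e'\<close>, with a remainder that has passed through
  \<open>A\<close> twice.\<close>

lemma taylor_stage_error:
  assumes F: "\<And>k. k < d \<Longrightarrow> taylor p (Ff k) (F k)"
    and J: "\<And>k l. k < d \<Longrightarrow> l < d \<Longrightarrow> taylor p (Jf k l) (J k l)"
    and Y: "\<And>k. k < d \<Longrightarrow> taylor p (Yf k) (case_nat 0 (\<lambda>n. F k n / real (Suc n)))"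
    and R: "\<And>i k. i < s \<Longrightarrow> k < d \<Longrightarrow> R i k \<in> O[nhds 0](\<lambda>h. h ^ p)"
    and e: "\<And>i k h. i < s \<Longrightarrow> k < d \<Longrightarrow> e i k h =
      h * (\<Sum>j<i. A i j * (Ff k (c j * h) + (\<Sum>l<d. Jf k l (c j * h) * e j l h)))
        - Yf k (c i * h) + R i k h"
  shows "i < s \<Longrightarrow> k < d \<Longrightarrow> taylor p (e i k) (\<lambda>n. err_coeff d A c F J n i k)"
proof (induction i arbitrary: k rule: less_induct)
  case (less i)
  let ?E = "err_coeff d A c F J"
  define X where "X n = (\<Sum>j<i. A i j * (F k n * c j ^ n
      + (\<Sum>l<d. \<Sum>m\<le>n. (J k l m * c j ^ m) * ?E (n - m) j l)))" for n
  have "taylor p (\<lambda>h. \<Sum>j<i. A i j * (Ff k (c j * h) + (\<Sum>l<d. Jf k l (c j * h) * e j l h))) X"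
    unfolding X_def using less F J
    by (intro taylor_sum taylor_cmult taylor_add taylor_mult taylor_scale) auto
  \<comment> \<open>The order gained from the factor \<open>h\<close> is given up again, since
    \<open>R\<close> is controlled only to order \<open>p\<close>.\<close>
  from taylor_mono[OF taylor_mult_id[OF this], of p]
  have 1: "taylor p (\<lambda>h. h * (\<Sum>j<i. A i j * (Ff k (c j * h) + (\<Sum>l<d. Jf k l (c j * h) * e j l h))))
      (case_nat 0 X)" by simp
  have "taylor p (\<lambda>h. h * (\<Sum>j<i. A i j * (Ff k (c j * h) + (\<Sum>l<d. Jf k l (c j * h) * e j l h)))
        - Yf k (c i * h) + R i k h)
      (\<lambda>n. case_nat 0 X n - case_nat 0 (\<lambda>n. F k n / real (Suc n)) n * c i ^ n)"
    using less.prems by (intro taylor_add_bigo taylor_diff 1 taylor_scale Y R)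
  moreover have "(\<lambda>n. case_nat 0 X n - case_nat 0 (\<lambda>n. F k n / real (Suc n)) n * c i ^ n) = (\<lambda>n. ?E n i k)"
  proof
    fix n
    show "case_nat 0 X n - case_nat 0 (\<lambda>n. F k n / real (Suc n)) n * c i ^ n = ?E n i k"
    proof (cases n)
      case (Suc m)
      have "X m = F k m * (\<Sum>j<i. A i j * c j ^ m)
          + (\<Sum>j<i. A i j * (\<Sum>l<d. \<Sum>r\<le>m. J k l r * c j ^ r * ?E (m - r) j l))"
        unfolding X_def by (simp add: distrib_left sum.distrib sum_distrib_left mult.left_commute)
      then show ?thesis
        using Suc by (simp add: err_coeff.simps(2) right_diff_distrib)
    qed simp
  qed
  ultimately show ?case
    unfolding e[OF less.prems, abs_def, symmetric] by simp
qed

text \<open>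
  Common frame for scalar and vector problems: \<open>S = Y - y0\<close>, \<open>G = f(Y)\<close>, \<open>Ff = y'(x0 + \<cdot>)\<close>,
  \<open>Yf = y(x0 + \<cdot>) - y0\<close>, and \<open>Jf\<close> is the Jacobian of \<open>f\<close> in \<open>y\<close> along the solution. Nonautonomous
  problems fit because \<open>f\<close> itself does not occur.
\<close>

locale butcher_problem =
  fixes d :: nat and S G :: "nat \<Rightarrow> nat \<Rightarrow> real \<Rightarrow> real"
    and Ff Yf :: "nat \<Rightarrow> real \<Rightarrow> real" and Jf :: "nat \<Rightarrow> nat \<Rightarrow> real \<Rightarrow> real"
    and F :: "nat \<Rightarrow> nat \<Rightarrow> real" and J :: "nat \<Rightarrow> nat \<Rightarrow> nat \<Rightarrow> real"
  assumes stage: "\<And>i k h. i < 8 \<Longrightarrow> k < d \<Longrightarrow> S i k h = h * (\<Sum>j<i. butcher_A i j * G j k h)"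
    and stage_bigo: "\<And>i k. i < 8 \<Longrightarrow> k < d \<Longrightarrow> S i k \<in> O[nhds 0](\<lambda>h. h)"
    and remainder: "\<And>i k. i < 8 \<Longrightarrow> k < d \<Longrightarrow>
      (\<lambda>h. G i k h - Ff k (butcher_c i * h)
          - (\<Sum>l<d. Jf k l (butcher_c i * h) * (S i l h - Yf l (butcher_c i * h))))
        \<in> O[nhds 0](\<lambda>h. (\<Sum>l<d. \<bar>S i l h - Yf l (butcher_c i * h)\<bar>)\<^sup>2)"
    and taylor_F: "\<And>k. k < d \<Longrightarrow> taylor 6 (Ff k) (F k)"
    and taylor_J: "\<And>k l. k < d \<Longrightarrow> l < d \<Longrightarrow> taylor 6 (Jf k l) (J k l)"
    and taylor_Y: "\<And>k. k < d \<Longrightarrow> taylor 7 (Yf k) (case_nat 0 (\<lambda>n. F k n / real (Suc n)))"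
begin

definition e :: "nat \<Rightarrow> nat \<Rightarrow> real \<Rightarrow> real" where
  "e i k h = S i k h - Yf k (butcher_c i * h)"

definition K :: "nat \<Rightarrow> nat \<Rightarrow> real \<Rightarrow> real" where
  "K i k h = G i k h - Ff k (butcher_c i * h) - (\<Sum>l<d. Jf k l (butcher_c i * h) * e i l h)"

abbreviation E :: "nat \<Rightarrow> nat \<Rightarrow> nat \<Rightarrow> real" where
  "E \<equiv> err_coeff d butcher_A butcher_c F J"

definition step_error :: "nat \<Rightarrow> real \<Rightarrow> real" where
  "step_error k h = h * (\<Sum>i<8. butcher_b i * G i k h) - Yf k h"

lemma weighted_G: "(\<Sum>j<n. w j * G j k h)
    = (\<Sum>j<n. w j * (Ff k (butcher_c j * h) + (\<Sum>l<d. Jf k l (butcher_c j * h) * e j l h) + K j k h))"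
  by (simp add: K_def)

section \<open>Closed forms of the leading error coefficients\<close>

lemma E_1: "i < 8 \<Longrightarrow> E (Suc 0) i k = 0"
  by (simp add: err_coeff.simps(2) butcher_row_sum)

lemma E_2:
  assumes "i < 8"
  shows "E 2 i k = F k 1 * defect_2 i"
proof -
  have "E (Suc 1) i k = F k 1 * ((\<Sum>j<i. butcher_A i j * butcher_c j ^ 1) - butcher_c i ^ 2 / 2)"
    using assms by (subst err_coeff.simps(2)) (auto simp: E_1 numeral_2_eq_2 intro!: sum.neutral)
  then show ?thesis using butcher_defect_2[OF assms] by (simp add: numeral_2_eq_2)
qed

text \<open>Component \<open>k\<close> of the product \<open>J_m F_n\<close> of a Taylor coefficient
  matrix of the Jacobian with a Taylor coefficient of the slope; \<open>JJF\<close> is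
  \<open>J_0 J_0 F_1\<close>.\<close>

definition JF :: "nat \<Rightarrow> nat \<Rightarrow> nat \<Rightarrow> real" where
  "JF m n k = (\<Sum>l<d. J k l m * F l n)"

definition JJF :: "nat \<Rightarrow> real" where
  "JJF k = (\<Sum>l<d. J k l 0 * JF 0 1 l)"

lemma E_3:
  assumes "i < 8"
  shows "E 3 i k = F k 2 * defect_3 i + JF 0 1 k * A_defect_2 i"
proof -
  \<comment> \<open>Only \<open>m = 0\<close> survives in the convolution, since the error
    coefficients of index 0 and 1 vanish.\<close>
  have inner: "(\<Sum>l<d. \<Sum>m\<le>2. J k l m * butcher_c j ^ m * E (2 - m) j l) = defect_2 j * JF 0 1 k"
    if "j < i" for j
    using that assms
    by (simp add: numeral_2_eq_2 E_1 E_2[unfolded numeral_2_eq_2] JF_def sum_distrib_left mult_ac)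
  have "(\<Sum>j<i. butcher_A i j * (\<Sum>l<d. \<Sum>m\<le>2. J k l m * butcher_c j ^ m * E (2 - m) j l))
      = (\<Sum>j<i. butcher_A i j * (defect_2 j * JF 0 1 k))"
    by (intro sum.cong) (simp_all add: inner)
  then have "E (Suc 2) i k = F k 2 * ((\<Sum>j<i. butcher_A i j * butcher_c j ^ 2) - butcher_c i ^ 3 / 3)
      + (\<Sum>j<i. butcher_A i j * defect_2 j) * JF 0 1 k"
    by (subst err_coeff.simps(2)) (simp add: sum_distrib_right mult.assoc numeral_3_eq_3)
  then show ?thesis using butcher_defect_3[OF assms] butcher_A_defect_2[OF assms]
    by (simp add: numeral_3_eq_3 numeral_2_eq_2)
qed

lemma E_4:
  assumes "i < 8"
  shows "E 4 i k = F k 3 * defect_4 i + JF 0 2 k * A_defect_3 i + JJF k * AA_defect_2 i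
      + JF 1 1 k / 2 * A_defect_2 i"
proof -
  have inner: "(\<Sum>l<d. \<Sum>m\<le>3. J k l m * butcher_c j ^ m * E (3 - m) j l)
      = defect_3 j * JF 0 2 k + A_defect_2 j * JJF k + defect_2 j * (JF 1 1 k / 2)"
    if "j < i" for j
  proof -
    have j: "j < 8" using that assms by simp
    have "(\<Sum>m\<le>3. J k l m * butcher_c j ^ m * E (3 - m) j l)
        = J k l 0 * E 3 j l + J k l 1 * butcher_c j * E 2 j l" for l
      using E_1[OF j] by (simp add: eval_nat_numeral)
    also have "J k l 0 * E 3 j l + J k l 1 * butcher_c j * E 2 j l
        = defect_3 j * (J k l 0 * F l 2) + A_defect_2 j * (J k l 0 * JF 0 1 l)
          + defect_2 j / 2 * (J k l 1 * F l 1)" for l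
    proof -
      have "J k l 1 * butcher_c j * E 2 j l = J k l 1 * F l 1 * (butcher_c j * defect_2 j)"
        by (simp add: E_2[OF j])
      then show ?thesis unfolding E_3[OF j] c_defect_2 by (simp add: algebra_simps)
    qed
    finally show ?thesis
      by (simp add: sum.distrib JJF_def JF_def sum_distrib_left sum_divide_distrib)
  qed
  have "(\<Sum>j<i. butcher_A i j * (\<Sum>l<d. \<Sum>m\<le>3. J k l m * butcher_c j ^ m * E (3 - m) j l))
      = (\<Sum>j<i. butcher_A i j * (defect_3 j * JF 0 2 k + A_defect_2 j * JJF k + defect_2 j * (JF 1 1 k / 2)))"
    by (intro sum.cong) (simp_all add: inner)
  then have "E (Suc 3) i k = F k 3 * ((\<Sum>j<i. butcher_A i j * butcher_c j ^ 3) - butcher_c i ^ 4 / 4)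
      + (\<Sum>j<i. butcher_A i j * defect_3 j) * JF 0 2 k + (\<Sum>j<i. butcher_A i j * A_defect_2 j) * JJF k
      + (\<Sum>j<i. butcher_A i j * defect_2 j) * (JF 1 1 k / 2)"
    by (subst err_coeff.simps(2))
      (simp add: sum_distrib_right distrib_left sum.distrib mult.assoc eval_nat_numeral)
  then show ?thesis
    unfolding butcher_defect_4[OF assms] butcher_A_defect_3[OF assms] butcher_A_defect_2[OF assms]
      butcher_AA_defect_2[OF assms]
    by (simp add: eval_nat_numeral)
qed

lemma weighted_E_2:
  "(\<Sum>i<8. butcher_b i * (butcher_c i ^ m * E 2 i k))
   = F k 1 * (\<Sum>i<8. butcher_b i * (butcher_c i ^ m * defect_2 i))"
  unfolding sum_distrib_left by (intro sum.cong) (simp_all add: E_2)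

lemma weighted_E_3:
  "(\<Sum>i<8. butcher_b i * (butcher_c i ^ m * E 3 i k))
   = F k 2 * (\<Sum>i<8. butcher_b i * (butcher_c i ^ m * defect_3 i))
     + JF 0 1 k * (\<Sum>i<8. butcher_b i * (butcher_c i ^ m * A_defect_2 i))"
  unfolding sum_distrib_left sum.distrib[symmetric]
  by (intro sum.cong) (simp_all add: E_3 algebra_simps)

lemma weighted_E_4:
  "(\<Sum>i<8. butcher_b i * (butcher_c i ^ m * E 4 i k))
   = F k 3 * (\<Sum>i<8. butcher_b i * (butcher_c i ^ m * defect_4 i))
     + JF 0 2 k * (\<Sum>i<8. butcher_b i * (butcher_c i ^ m * A_defect_3 i))
     + JJF k * (\<Sum>i<8. butcher_b i * (butcher_c i ^ m * AA_defect_2 i))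
     + JF 1 1 k / 2 * (\<Sum>i<8. butcher_b i * (butcher_c i ^ m * A_defect_2 i))"
  unfolding sum_distrib_left sum.distrib[symmetric]
  by (intro sum.cong) (simp_all add: E_4 algebra_simps)

text \<open>The weight \<open>m + n\<close> is the power of \<open>h\<close> before the outer factor
  \<open>h\<close> of the step, so the bound 4 covers exactly the conditions through order
  five.\<close>

lemma weighted_E_eq_0:
  assumes "m + n \<le> 4"
  shows "(\<Sum>i<8. butcher_b i * (butcher_c i ^ m * E n i k)) = 0"
proof -
  from assms consider "n = 0" | "n = Suc 0" | "n = 2" "m = 0" | "n = 2" "m = 1" | "n = 2" "m = 2"
    | "n = 3" "m = 0" | "n = 3" "m = 1" | "n = 4" "m = 0" by linarith
  then show ?thesis
  proof cases
    case 2
    then show ?thesis by (simp add: E_1)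
  qed (simp_all only: err_coeff.simps(1) weighted_E_2 weighted_E_3 weighted_E_4 butcher_b_orthogonal
        mult_zero_right add_0_right sum.neutral_const)
qed

section \<open>Bootstrapping bounds for the stage errors\<close>

lemma e_eq:
  assumes "i < 8" "k < d"
  shows "e i k h = h * (\<Sum>j<i. butcher_A i j * (Ff k (butcher_c j * h)
       + (\<Sum>l<d. Jf k l (butcher_c j * h) * e j l h))) - Yf k (butcher_c i * h)
       + h * (\<Sum>j<i. butcher_A i j * K j k h)"
  unfolding e_def[of i] stage[OF assms] weighted_G by (simp add: distrib_left sum.distrib)

text \<open>A bound \<open>h ^ p\<close> on the remainders yields the stage errors one order
  further, and \<open>K_bigo\<close> doubles whatever order is read off. The cap on \<open>p\<close>
  reflects that \<open>F\<close> and \<open>J\<close> are expanded to order 6.\<close>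

lemma taylor_e:
  assumes K: "\<And>j l. j < 8 \<Longrightarrow> l < d \<Longrightarrow> K j l \<in> O[nhds 0](\<lambda>h. h ^ p)" and "p \<le> 5"
    and "i < 8" "k < d"
  shows "taylor (Suc p) (e i k) (\<lambda>n. E n i k)"
proof (rule taylor_stage_error[OF _ _ _ _ e_eq assms(3,4)])
  show "taylor (Suc p) (Ff k) (F k)" if "k < d" for k
    using assms(2) by (intro taylor_mono[OF taylor_F[OF that]]) simp
  show "taylor (Suc p) (Yf k) (case_nat 0 (\<lambda>n. F k n / real (Suc n)))" if "k < d" for k
    using assms(2) by (intro taylor_mono[OF taylor_Y[OF that]]) simp
  show "taylor (Suc p) (Jf k l) (J k l)" if "k < d" "l < d" for k l
    using assms(2) by (intro taylor_mono[OF taylor_J[OF that]]) simp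
  show "(\<lambda>h. h * (\<Sum>j<i. butcher_A i j * K j k h)) \<in> O[nhds 0](\<lambda>h. h ^ Suc p)"
    if "i < 8" "k < d" for i k
    using K that by (intro bigo_id_mult big_sum_in_bigo bigo_cmult) auto
qed

lemma K_bigo:
  assumes "i < 8" "k < d" and e: "\<And>l. l < d \<Longrightarrow> e i l \<in> O[nhds 0](\<lambda>h. h ^ p)"
  shows "K i k \<in> O[nhds 0](\<lambda>h. h ^ (p + p))"
proof -
  have "(\<lambda>h. \<Sum>l<d. \<bar>e i l h\<bar>) \<in> O[nhds 0](\<lambda>h. h ^ p)"
    using e by (intro big_sum_in_bigo) auto
  from bigo_power_mult[OF this this]
  have "(\<lambda>h. (\<Sum>l<d. \<bar>e i l h\<bar>)\<^sup>2) \<in> O[nhds 0](\<lambda>h. h ^ (p + p))"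
    by (simp add: power2_eq_square)
  moreover have "K i k \<in> O[nhds 0](\<lambda>h. (\<Sum>l<d. \<bar>e i l h\<bar>)\<^sup>2)"
    using remainder[OF assms(1,2)] by (simp add: K_def[abs_def] e_def)
  ultimately show ?thesis by (rule landau_o.big_trans[rotated])
qed

lemma e_bigo_1: "i < 8 \<Longrightarrow> k < d \<Longrightarrow> e i k \<in> O[nhds 0](\<lambda>h. h ^ 1)"
  unfolding e_def[abs_def]
  by (rule sum_in_bigo(2)[OF _ bigo_power_scale[OF taylor_bigo[OF taylor_Y]]])
    (simp_all add: stage_bigo)

text \<open>From \<open>e = O(h)\<close> the remainder is \<open>O(h^2)\<close>, so \<open>e\<close>
  has an expansion to order 3. Its coefficients 0 and 1 vanish, and so does coefficient 2 away from
  stage 1, where \<open>defect_2\<close> is zero.\<close>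

lemma e_bigo_2: "i < 8 \<Longrightarrow> k < d \<Longrightarrow> e i k \<in> O[nhds 0](\<lambda>h. h ^ 2)"
  and e_bigo_3: "i < 8 \<Longrightarrow> k < d \<Longrightarrow> i \<noteq> 1 \<Longrightarrow> e i k \<in> O[nhds 0](\<lambda>h. h ^ 3)"
proof -
  have "taylor (Suc 2) (e i k) (\<lambda>n. E n i k)" if "i < 8" "k < d" for i k
    using that K_bigo[OF _ _ e_bigo_1] by (intro taylor_e) (simp_all add: numeral_2_eq_2)
  note t = this
  have z: "E n i k = 0" if "n < 2" "i < 8" for n i k
    using that by (cases n) (auto simp: E_1 numeral_2_eq_2 less_Suc_eq)
  show "e i k \<in> O[nhds 0](\<lambda>h. h ^ 2)" if "i < 8" "k < d"
    using that z by (intro taylor_bigo[OF t]) auto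
  show "e i k \<in> O[nhds 0](\<lambda>h. h ^ 3)" if "i < 8" "k < d" "i \<noteq> 1"
  proof (rule taylor_bigo[OF t])
    have "defect_2 i = 0" using that(1,3) by (elim less_8_cases) (simp_all add: defect_2_def nth_default_def)
    then show "E n i k = 0" if "n < 3" for n
      using that z \<open>i < 8\<close> E_2 by (cases "n = 2") auto
  qed (use that in auto)
qed

lemma K_bigo_4: "i < 8 \<Longrightarrow> k < d \<Longrightarrow> K i k \<in> O[nhds 0](\<lambda>h. h ^ 4)"
  using K_bigo[OF _ _ e_bigo_2] by simp

lemma K_bigo_6: "i < 8 \<Longrightarrow> k < d \<Longrightarrow> i \<noteq> 1 \<Longrightarrow> K i k \<in> O[nhds 0](\<lambda>h. h ^ 6)"
  using K_bigo[OF _ _ e_bigo_3] by simp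

text \<open>Serves \<open>butcher_b\<close> and \<open>b_A\<close>: both vanish at stage 1, the one
  stage where the remainder is bounded only by \<open>h ^ 4\<close>.\<close>

lemma weighted_K_bigo:
  assumes "k < d" and "w 1 = 0"
  shows "(\<lambda>h. \<Sum>i<8. w i * K i k h) \<in> O[nhds 0](\<lambda>h. h ^ 6)"
proof (rule big_sum_in_bigo)
  fix i :: nat assume "i \<in> {..<8}"
  then show "(\<lambda>h. w i * K i k h) \<in> O[nhds 0](\<lambda>h. h ^ 6)"
    using assms K_bigo_6[of i k] by (cases "i = 1") (auto intro: bigo_cmult)
qed

section \<open>Order conditions for the local error\<close>

definition local_coeff :: "nat \<Rightarrow> nat \<Rightarrow> real" where
  "local_coeff k n = (\<Sum>i<8. butcher_b i * (F k n * butcher_c i ^ n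
      + (\<Sum>l<d. \<Sum>m\<le>n. J k l m * butcher_c i ^ m * E (n - m) i l)))"

text \<open>Quadrature produces the Taylor coefficient of the exact increment, so the double sum is
  the whole obstruction to the next order.\<close>

lemma local_coeff_eq:
  assumes "n < 6"
  shows "local_coeff k n = F k n / real (Suc n)
    + (\<Sum>l<d. \<Sum>m\<le>n. J k l m * (\<Sum>i<8. butcher_b i * (butcher_c i ^ m * E (n - m) i l)))"
proof -
  have "local_coeff k n = F k n * (\<Sum>i<8. butcher_b i * butcher_c i ^ n)
      + (\<Sum>i<8. \<Sum>l<d. \<Sum>m\<le>n. butcher_b i * (J k l m * butcher_c i ^ m * E (n - m) i l))"
    unfolding local_coeff_def by (simp add: distrib_left sum.distrib sum_distrib_left mult_ac)
  also have "(\<Sum>i<8. \<Sum>l<d. \<Sum>m\<le>n. butcher_b i * (J k l m * butcher_c i ^ m * E (n - m) i l))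
      = (\<Sum>l<d. \<Sum>m\<le>n. \<Sum>i<8. butcher_b i * (J k l m * butcher_c i ^ m * E (n - m) i l))"
    by (subst sum.swap, rule sum.cong[OF refl], subst sum.swap) simp
  finally show ?thesis
    by (simp add: butcher_quadrature[OF assms] sum_distrib_left mult_ac)
qed

lemma local_coeff_low: "n < 5 \<Longrightarrow> local_coeff k n = F k n / real (Suc n)"
  by (simp add: local_coeff_eq weighted_E_eq_0)

text \<open>The stage errors are abstracted to \<open>u\<close> so that both \<open>e\<close> and
  the corrected \<open>e'\<close> can be inserted.\<close>

lemma taylor_step:
  assumes "\<And>i l. i < 8 \<Longrightarrow> l < d \<Longrightarrow> taylor p (u i l) (\<lambda>n. E n i l)" "p \<le> 6" "k < d"
  shows "taylor (Suc p) (\<lambda>h. h * (\<Sum>i<8. butcher_b i * (Ff k (butcher_c i * h)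
       + (\<Sum>l<d. Jf k l (butcher_c i * h) * u i l h))) - Yf k h)
     (\<lambda>n. case_nat 0 (local_coeff k) n - case_nat 0 (\<lambda>n. F k n / real (Suc n)) n)"
proof (rule taylor_diff[OF taylor_mult_id])
  show "taylor p (\<lambda>h. \<Sum>i<8. butcher_b i * (Ff k (butcher_c i * h)
       + (\<Sum>l<d. Jf k l (butcher_c i * h) * u i l h))) (local_coeff k)"
    unfolding local_coeff_def using assms taylor_mono[OF taylor_F] taylor_mono[OF taylor_J]
    by (intro taylor_sum taylor_cmult taylor_add taylor_mult taylor_scale) auto
  show "taylor (Suc p) (Yf k) (case_nat 0 (\<lambda>n. F k n / real (Suc n)))"
    using assms(2,3) by (intro taylor_mono[OF taylor_Y]) auto
qed

theorem step_error_order_5: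
  assumes "k < d"
  shows "step_error k \<in> O[nhds 0](\<lambda>h. h ^ 6)"
proof -
  have "taylor (Suc 4) (e i l) (\<lambda>n. E n i l)" if "i < 8" "l < d" for i l
    using that K_bigo_4 by (intro taylor_e) auto
  note t = taylor_step[OF this, of k]
  have "(\<lambda>h. h * (\<Sum>i<8. butcher_b i * (Ff k (butcher_c i * h)
       + (\<Sum>l<d. Jf k l (butcher_c i * h) * e i l h))) - Yf k h) \<in> O[nhds 0](\<lambda>h. h ^ 6)"
    using assms by (intro taylor_bigo[OF t]) (auto simp: local_coeff_low split: nat.split)
  moreover have "(\<lambda>h. h * (\<Sum>i<8. butcher_b i * K i k h)) \<in> O[nhds 0](\<lambda>h. h ^ 6)"
    by (rule bigo_power_mono[OF bigo_id_mult[OF weighted_K_bigo[OF assms]]])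
      (simp_all add: butcher_b_values)
  ultimately have "(\<lambda>h. h * (\<Sum>i<8. butcher_b i * (Ff k (butcher_c i * h)
       + (\<Sum>l<d. Jf k l (butcher_c i * h) * e i l h))) - Yf k h
       + h * (\<Sum>i<8. butcher_b i * K i k h)) \<in> O[nhds 0](\<lambda>h. h ^ 6)"
    by (rule sum_in_bigo(1))
  then show ?thesis
    unfolding step_error_def[abs_def] weighted_G by (simp add: distrib_left sum.distrib algebra_simps)
qed

text \<open>
  The first-order effect of the Taylor remainders \<open>K\<close> on the stages is split off, so that \<open>e'\<close> has a
  Taylor expansion although \<open>K\<close> is only known to be \<open>O(h\<^sup>4)\<close>.
\<close>

definition e' :: "nat \<Rightarrow> nat \<Rightarrow> real \<Rightarrow> real" where
  "e' i k h = e i k h - h * (\<Sum>j<i. butcher_A i j * K j k h)"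

lemma A_K_bigo: "i < 8 \<Longrightarrow> k < d \<Longrightarrow>
    (\<lambda>h. \<Sum>j<i. butcher_A i j * K j k h) \<in> O[nhds 0](\<lambda>h. h ^ 4)"
  using K_bigo_4 by (intro big_sum_in_bigo bigo_cmult) auto

lemma Jf_bigo:
  assumes "k < d" "l < d"
  shows "(\<lambda>h. Jf k l (c * h)) \<in> O[nhds 0](\<lambda>h. h ^ 0)"
    and "(\<lambda>h. Jf k l (c * h) - J k l 0) \<in> O[nhds 0](\<lambda>h. h ^ 1)"
proof -
  show "(\<lambda>h. Jf k l (c * h)) \<in> O[nhds 0](\<lambda>h. h ^ 0)"
    by (rule bigo_power_scale[OF taylor_bigo[OF taylor_J[OF assms]]]) auto
  have "taylor 1 (Jf k l) (J k l)" by (rule taylor_mono[OF taylor_J[OF assms]]) simp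
  then have "(\<lambda>h. Jf k l h - J k l 0) \<in> O[nhds 0](\<lambda>h. h ^ 1)" by (simp add: taylor_def)
  from bigo_power_scale[OF this] show "(\<lambda>h. Jf k l (c * h) - J k l 0) \<in> O[nhds 0](\<lambda>h. h ^ 1)" .
qed

lemma taylor_e':
  assumes "i < 8" "k < d"
  shows "taylor 6 (e' i k) (\<lambda>n. E n i k)"
proof (rule taylor_stage_error[OF taylor_F taylor_J _ _ _ assms])
  show "taylor 6 (Yf k) (case_nat 0 (\<lambda>n. F k n / real (Suc n)))" if "k < d" for k
    by (rule taylor_mono[OF taylor_Y[OF that]]) simp
  \<comment> \<open>After the split, the remainders left in the recursion have passed through
    \<open>A\<close> twice: two factors \<open>h\<close> and \<open>O(h^4)\<close> give
    \<open>O(h^6)\<close>.\<close>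
  define R where "R i k h = h * (\<Sum>j<i. butcher_A i j * (\<Sum>l<d. Jf k l (butcher_c j * h) *
      (h * (\<Sum>r<j. butcher_A j r * K r l h))))" for i k h
  show "R i k \<in> O[nhds 0](\<lambda>h. h ^ 6)" if "i < 8" "k < d" for i k
  proof -
    have "(\<lambda>h. Jf k l (butcher_c j * h) * (h * (\<Sum>r<j. butcher_A j r * K r l h))) \<in> O[nhds 0](\<lambda>h. h ^ 5)"
      if "j < 8" "l < d" for j l
      using bigo_power_mult[OF Jf_bigo(1) bigo_id_mult[OF A_K_bigo[OF that]], of k] \<open>k < d\<close> that by simp
    then have "(\<lambda>h. \<Sum>j<i. butcher_A i j * (\<Sum>l<d. Jf k l (butcher_c j * h) *
        (h * (\<Sum>r<j. butcher_A j r * K r l h)))) \<in> O[nhds 0](\<lambda>h. h ^ 5)"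
      using \<open>i < 8\<close> by (intro big_sum_in_bigo bigo_cmult) auto
    from bigo_id_mult[OF this] show ?thesis by (simp add: R_def[abs_def])
  qed
  show "e' i k h = h * (\<Sum>j<i. butcher_A i j * (Ff k (butcher_c j * h)
      + (\<Sum>l<d. Jf k l (butcher_c j * h) * e' j l h))) - Yf k (butcher_c i * h) + R i k h"
    if "i < 8" "k < d" for i k h
  proof -
    have "e j l h = e' j l h + h * (\<Sum>r<j. butcher_A j r * K r l h)" for j l
      by (simp add: e'_def)
    then show ?thesis
      unfolding e'_def[of i] e_eq[OF that] R_def by (simp add: distrib_left sum.distrib)
  qed
qed

text \<open>The bound \<open>h * O(h^4)\<close> is one power short. Splitting \<open>Jf\<close> into
  its value at 0 and the rest gains it in both parts: the constant part meets
  \<open>b_A 1 = 0\<close>, and the rest is itself \<open>O(h)\<close>.\<close>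

lemma coupled_K_bigo:
  assumes "k < d" "l < d"
  shows "(\<lambda>h. \<Sum>i<8. butcher_b i * (Jf k l (butcher_c i * h) * (h * (\<Sum>j<i. butcher_A i j * K j l h))))
    \<in> O[nhds 0](\<lambda>h. h ^ 6)"
proof -
  have eq: "h * (J k l 0 * (\<Sum>i<8. butcher_b i * T i) + (\<Sum>i<8. butcher_b i * ((g i - J k l 0) * T i)))
      = (\<Sum>i<8. butcher_b i * (g i * (h * T i)))" for h and g T :: "nat \<Rightarrow> real"
    unfolding sum_distrib_left sum.distrib[symmetric]
    by (intro sum.cong refl) (simp add: algebra_simps)
  have "(\<lambda>h. J k l 0 * (\<Sum>j<8. b_A j * K j l h)) \<in> O[nhds 0](\<lambda>h. h ^ 5)"
    by (intro bigo_cmult bigo_power_mono[OF weighted_K_bigo[OF assms(2)]] butcher_b_A_orthogonal) simp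
  moreover have "(\<lambda>h. \<Sum>i<8. butcher_b i * ((Jf k l (butcher_c i * h) - J k l 0)
      * (\<Sum>j<i. butcher_A i j * K j l h))) \<in> O[nhds 0](\<lambda>h. h ^ 5)"
  proof (intro big_sum_in_bigo bigo_cmult)
    fix i :: nat assume "i \<in> {..<8}"
    then show "(\<lambda>h. (Jf k l (butcher_c i * h) - J k l 0) * (\<Sum>j<i. butcher_A i j * K j l h))
        \<in> O[nhds 0](\<lambda>h. h ^ 5)"
      using bigo_power_mult[OF Jf_bigo(2)[OF assms] A_K_bigo[OF _ assms(2)]] by simp
  qed
  ultimately have "(\<lambda>h. J k l 0 * (\<Sum>j<8. b_A j * K j l h) + (\<Sum>i<8. butcher_b i *
      ((Jf k l (butcher_c i * h) - J k l 0) * (\<Sum>j<i. butcher_A i j * K j l h)))) \<in> O[nhds 0](\<lambda>h. h ^ 5)"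
    by (rule sum_in_bigo(1))
  from bigo_id_mult[OF this] show ?thesis
    unfolding butcher_b_A[symmetric] eq by simp
qed

end

section \<open>Scalar problems and the cancellation of the paired conditions\<close>

locale butcher_scalar_problem = butcher_problem "Suc 0"
begin

text \<open>The fifth coefficient is needed only in its \<open>b\<close>-weighted form. Moving
  \<open>b\<close> through \<open>A\<close> leaves \<open>b_A\<close> against lower coefficients, so
  no closed form stage by stage is required.\<close>

lemma weighted_E_5: "(\<Sum>i<8. butcher_b i * E 5 i 0) =
    J 0 0 1 * (F 0 2 * (1/4140 + 1/27600 * sqrt 415)
      + J 0 0 0 * F 0 1 * (1/2760 + 1/18400 * sqrt 415))"
proof -
  define w where "w j = J 0 0 0 * E 4 j 0 + J 0 0 1 * (butcher_c j * E 3 j 0)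
      + J 0 0 2 * (butcher_c j ^ 2 * E 2 j 0)" for j
  have "E (Suc 4) i 0 = F 0 4 * ((\<Sum>j<i. butcher_A i j * butcher_c j ^ 4) - butcher_c i ^ 5 / 5)
      + (\<Sum>j<i. butcher_A i j * w j)" if "i < 8" for i
    using that E_1 by (subst err_coeff.simps(2)) (simp add: w_def eval_nat_numeral algebra_simps)
  then have "(\<Sum>i<8. butcher_b i * E 5 i 0) =
      (\<Sum>i<8. butcher_b i * (F 0 4 * ((\<Sum>j<i. butcher_A i j * butcher_c j ^ 4) - butcher_c i ^ 5 / 5)
      + (\<Sum>j<i. butcher_A i j * w j)))"
    by (intro sum.cong) (auto simp: eval_nat_numeral)
  also have "\<dots> = F 0 4 * ((\<Sum>i<8. butcher_b i * (\<Sum>j<i. butcher_A i j * butcher_c j ^ 4))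
      - (\<Sum>i<8. butcher_b i * butcher_c i ^ 5) / 5) + (\<Sum>i<8. butcher_b i * (\<Sum>j<i. butcher_A i j * w j))"
    by (simp add: sum.distrib sum_subtractf algebra_simps sum_distrib_left sum_divide_distrib)
  \<comment> \<open>The bracket after \<open>F 0 4\<close> is
    \<open>1/30 - (1/6) / 5 = 0\<close>.\<close>
  also have "\<dots> = (\<Sum>j<8. b_A j * w j)"
    using butcher_quadrature[of 5] unfolding butcher_b_A butcher_b_A_orthogonal by simp
  also have "\<dots> = (\<Sum>j<8. J 0 0 0 * F 0 3 * (b_A j * defect_4 j) + J 0 0 0 * JF 0 2 0 * (b_A j * A_defect_3 j)
      + J 0 0 0 * JJF 0 * (b_A j * AA_defect_2 j) + J 0 0 0 * JF 1 1 0 / 2 * (b_A j * A_defect_2 j)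
      + J 0 0 1 * F 0 2 * (b_A j * (butcher_c j * defect_3 j))
      + J 0 0 1 * JF 0 1 0 * (b_A j * (butcher_c j * A_defect_2 j)))"
  proof (intro sum.cong refl)
    fix j :: nat assume "j \<in> {..<8}"
    \<comment> \<open>Disjoint supports remove every term that contains
      \<open>defect_2\<close>.\<close>
    moreover have "b_A j = 0 \<or> defect_2 j = 0"
      using butcher_b_A_orthogonal(1) by (auto simp: defect_2_def nth_default_Cons split: nat.split)
    ultimately show "b_A j * w j = J 0 0 0 * F 0 3 * (b_A j * defect_4 j) + J 0 0 0 * JF 0 2 0 * (b_A j * A_defect_3 j)
      + J 0 0 0 * JJF 0 * (b_A j * AA_defect_2 j) + J 0 0 0 * JF 1 1 0 / 2 * (b_A j * A_defect_2 j)
      + J 0 0 1 * F 0 2 * (b_A j * (butcher_c j * defect_3 j))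
      + J 0 0 1 * JF 0 1 0 * (b_A j * (butcher_c j * A_defect_2 j))"
      by (elim disjE) (simp_all add: w_def E_2 E_3 E_4 algebra_simps)
  qed
  also have "\<dots> = J 0 0 1 * F 0 2 * (1/4140 + 1/27600 * sqrt 415)
      + J 0 0 1 * JF 0 1 0 * (1/2760 + 1/18400 * sqrt 415)"
    unfolding sum.distrib sum_distrib_left[symmetric] butcher_b_A_orthogonal butcher_paired_conditions
    by simp
  finally show ?thesis by (simp add: JF_def algebra_simps)
qed

text \<open>The fifth error coefficient enters multiplied by \<open>J_0\<close> and contains
  \<open>J_1\<close>; the fourth enters multiplied by \<open>J_1\<close> and contains
  \<open>J_0\<close>. The constants are opposite, so commuting the two numbers cancels the
  terms.\<close>

lemma local_coeff_5: "local_coeff 0 5 = F 0 5 / 6"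
proof -
  have "local_coeff 0 5 = F 0 5 / 6 + (\<Sum>m\<le>5. J 0 0 m * (\<Sum>i<8. butcher_b i * (butcher_c i ^ m * E (5 - m) i 0)))"
    by (simp add: local_coeff_eq)
  also have "(\<Sum>m\<le>5. J 0 0 m * (\<Sum>i<8. butcher_b i * (butcher_c i ^ m * E (5 - m) i 0)))
      = J 0 0 0 * (\<Sum>i<8. butcher_b i * E 5 i 0) + J 0 0 1 * (\<Sum>i<8. butcher_b i * (butcher_c i ^ 1 * E 4 i 0))
      + J 0 0 2 * (\<Sum>i<8. butcher_b i * (butcher_c i ^ 2 * E 3 i 0))
      + J 0 0 3 * (\<Sum>i<8. butcher_b i * (butcher_c i ^ 3 * E 2 i 0))"
    by (simp add: eval_nat_numeral E_1)
  also have "\<dots> = 0"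
    unfolding weighted_E_5 weighted_E_4 weighted_E_3 weighted_E_2 butcher_b_orthogonal
    by (simp add: butcher_paired_conditions butcher_b_orthogonal[simplified] JF_def JJF_def algebra_simps)
  finally show ?thesis by simp
qed

theorem step_error_order_6: "step_error 0 \<in> O[nhds 0](\<lambda>h. h ^ 7)"
proof -
  have low: "local_coeff 0 n = F 0 n / real (Suc n)" if "n < 6" for n
    using that local_coeff_low[of n 0] local_coeff_5 by (cases "n = 5") auto
  have "taylor (Suc 6) (\<lambda>h. h * (\<Sum>i<8. butcher_b i * (Ff 0 (butcher_c i * h)
       + (\<Sum>l<Suc 0. Jf 0 l (butcher_c i * h) * e' i l h))) - Yf 0 h)
     (\<lambda>n. case_nat 0 (local_coeff 0) n - case_nat 0 (\<lambda>n. F 0 n / real (Suc n)) n)"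
    by (rule taylor_step[OF taylor_e']) simp_all
  then have 1: "(\<lambda>h. h * (\<Sum>i<8. butcher_b i * (Ff 0 (butcher_c i * h)
       + (\<Sum>l<Suc 0. Jf 0 l (butcher_c i * h) * e' i l h))) - Yf 0 h) \<in> O[nhds 0](\<lambda>h. h ^ 7)"
    by (rule taylor_bigo) (auto simp: low split: nat.split)
  have 2: "(\<lambda>h. h * (\<Sum>i<8. butcher_b i * K i 0 h)) \<in> O[nhds 0](\<lambda>h. h ^ 7)"
    using bigo_id_mult[OF weighted_K_bigo[of 0 butcher_b]] by (simp add: butcher_b_values)
  have 3: "(\<lambda>h. h * (\<Sum>i<8. butcher_b i * (Jf 0 0 (butcher_c i * h)
      * (h * (\<Sum>j<i. butcher_A i j * K j 0 h))))) \<in> O[nhds 0](\<lambda>h. h ^ 7)"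
    using bigo_id_mult[OF coupled_K_bigo[of 0 0]] by simp
  have e: "e i 0 h = e' i 0 h + h * (\<Sum>j<i. butcher_A i j * K j 0 h)" for i h
    by (simp add: e'_def)
  have "step_error 0 h = h * (\<Sum>i<8. butcher_b i * (Ff 0 (butcher_c i * h)
       + (\<Sum>l<Suc 0. Jf 0 l (butcher_c i * h) * e i l h) + K i 0 h)) - Yf 0 h" for h
    by (simp only: step_error_def weighted_G)
  \<comment> \<open>The nonlinear remainders reach the step twice, directly through \<open>b\<close>
    and, via the part split off from \<open>e\<close>, through one Jacobian.\<close>
  then have step: "step_error 0 h = (h * (\<Sum>i<8. butcher_b i * (Ff 0 (butcher_c i * h)
       + (\<Sum>l<Suc 0. Jf 0 l (butcher_c i * h) * e' i l h))) - Yf 0 h)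
     + h * (\<Sum>i<8. butcher_b i * K i 0 h) + h * (\<Sum>i<8. butcher_b i * (Jf 0 0 (butcher_c i * h)
      * (h * (\<Sum>j<i. butcher_A i j * K j 0 h))))" for h
    by (simp add: e distrib_left sum.distrib)
  show ?thesis
    unfolding step[abs_def] by (rule sum_in_bigo(1)[OF sum_in_bigo(1)[OF 1 2] 3])
qed

end

section \<open>A vector problem with error of order six\<close>

lemma Ck_on_SucI:
  assumes "continuous_map (subtopology (Euclidean_space d) U) euclideanreal g"
    and "has_partials d U g g'" "\<And>i. i < d \<Longrightarrow> Ck_on d k U (g' i)"
  shows "Ck_on d (Suc k) U g"
  using assms by (auto simp: has_partials_def)

lemma Ck_on_const: "Ck_on d k U (\<lambda>_. c)"
proof (induction k arbitrary: c)
  case (Suc k)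
  show ?case
    by (subst Ck_on.simps(2)) (auto intro!: exI[of _ "\<lambda>_. 0"] Suc)
qed simp

lemma continuous_map_coordinate:
  "continuous_map (subtopology (Euclidean_space d) U) euclideanreal (\<lambda>z. z i)"
  unfolding Euclidean_space_def
  by (intro continuous_map_from_subtopology continuous_map_product_coordinates) simp

lemma Ck_on_coordinate: "Ck_on d k U (\<lambda>z. z i)"
proof (cases k)
  case (Suc n)
  have "has_partials d U (\<lambda>z. z i) (\<lambda>l _. if l = i then 1 else 0)"
    by (auto simp: has_partials_def)
  then show ?thesis
    unfolding Suc by (rule Ck_on_SucI[OF continuous_map_coordinate _ Ck_on_const])
qed (simp add: continuous_map_coordinate)

lemma Ck_on_add: "Ck_on d k U u \<Longrightarrow> Ck_on d k U v \<Longrightarrow> Ck_on d k U (\<lambda>z. u z + v z)"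
proof (induction k arbitrary: u v)
  case (Suc k)
  from Ck_on_Suc_partials[OF Suc.prems(1)] obtain u' where
    u': "has_partials d U u u'" "\<And>i. i < d \<Longrightarrow> Ck_on d k U (u' i)" by blast
  from Ck_on_Suc_partials[OF Suc.prems(2)] obtain v' where
    v': "has_partials d U v v'" "\<And>i. i < d \<Longrightarrow> Ck_on d k U (v' i)" by blast
  have "has_partials d U (\<lambda>z. u z + v z) (\<lambda>i z. u' i z + v' i z)"
    using u'(1) v'(1) unfolding has_partials_def by (auto intro!: DERIV_add)
  moreover have "Ck_on d k U (\<lambda>z. u' i z + v' i z)" if "i < d" for i
    using that by (intro Suc.IH u' v')
  moreover have "continuous_map (subtopology (Euclidean_space d) U) euclideanreal (\<lambda>z. u z + v z)"
    using Suc.prems by (intro continuous_map_add Ck_on_imp_continuous)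
  ultimately show ?case by (intro Ck_on_SucI)
qed (auto intro: continuous_map_add)

lemma Ck_on_mult: "Ck_on d k U u \<Longrightarrow> Ck_on d k U v \<Longrightarrow> Ck_on d k U (\<lambda>z. u z * v z)"
proof (induction k arbitrary: u v)
  case (Suc k)
  from Ck_on_Suc_partials[OF Suc.prems(1)] obtain u' where
    u': "has_partials d U u u'" "\<And>i. i < d \<Longrightarrow> Ck_on d k U (u' i)" by blast
  from Ck_on_Suc_partials[OF Suc.prems(2)] obtain v' where
    v': "has_partials d U v v'" "\<And>i. i < d \<Longrightarrow> Ck_on d k U (v' i)" by blast
  have "has_partials d U (\<lambda>z. u z * v z) (\<lambda>i z. u' i z * v z + v' i z * u z)"
    unfolding has_partials_def
  proof (intro allI impI ballI)
    fix i z assume "i < d" "z \<in> U"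
    then show "((\<lambda>t. u (z(i := t)) * v (z(i := t))) has_real_derivative u' i z * v z + v' i z * u z) (at (z i))"
      using DERIV_mult[of "\<lambda>t. u (z(i := t))" "u' i z" "z i" UNIV "\<lambda>t. v (z(i := t))" "v' i z"]
        u'(1) v'(1) unfolding has_partials_def by simp
  qed
  moreover have "Ck_on d k U (\<lambda>z. u' i z * v z + v' i z * u z)" if "i < d" for i
    using that Suc.prems[THEN Ck_on_SucD] by (intro Ck_on_add Suc.IH u' v')
  moreover have "continuous_map (subtopology (Euclidean_space d) U) euclideanreal (\<lambda>z. u z * v z)"
    using Suc.prems by (intro continuous_map_real_mult Ck_on_imp_continuous)
  ultimately show ?case by (intro Ck_on_SucI)
qed (auto intro: continuous_map_real_mult)

text \<open>
  The system \<open>x' = 1\<close>, \<open>u' = x\<^sup>2\<close>, \<open>v' = u\<close>, \<open>w' = x v\<close> isolates one of the order conditions that fail: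
  \<open>w(h) = h\<^sup>6 / 72\<close>, whereas the method returns \<open>h\<^sup>6\<close> times \<open>b\<^sup>T C A A c\<^sup>2\<close>.
\<close>

definition cascade :: "(nat \<Rightarrow> real) \<Rightarrow> nat \<Rightarrow> real" where
  "cascade z = (\<lambda>_. 0)(0 := 1, 1 := z 0 * z 0, 2 := z 1, 3 := z 0 * z 2)"

definition cascade_solution :: "real \<Rightarrow> nat \<Rightarrow> real" where
  "cascade_solution t = (\<lambda>_. 0)(0 := t, 1 := t ^ 3 / 3, 2 := t ^ 4 / 12, 3 := t ^ 6 / 72)"

lemma less_4_cases:
  assumes "i < (4::nat)"
  obtains "i = 0" | "i = 1" | "i = 2" | "i = 3"
  using assms by linarith

lemma smooth_cascade: "smooth_near_vector 4 cascade (\<lambda>_. 0)"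
  unfolding smooth_near_vector_def
proof (intro exI[of _ "topspace (Euclidean_space 4)"] conjI ballI allI impI)
  show "cascade z \<in> topspace (Euclidean_space 4)" for z
    by (simp add: cascade_def topspace_Euclidean_space)
  show "smooth_on 4 (topspace (Euclidean_space 4)) (\<lambda>z. cascade z i)" if "i < 4" for i
    using that unfolding smooth_on_def cascade_def
    by (elim less_4_cases) (auto intro!: Ck_on_const Ck_on_mult Ck_on_coordinate)
  show "openin (Euclidean_space 4) (topspace (Euclidean_space 4))" by (rule openin_topspace)
qed (simp add: topspace_Euclidean_space)

lemma solves_cascade: "solves_vector 4 cascade (\<lambda>_. 0) 0 cascade_solution"
  unfolding solves_vector_def
proof (intro conjI always_eventually allI impI)
  show "((\<lambda>t. cascade_solution t i) has_real_derivative cascade (cascade_solution x) i) (at x)"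
    if "i < 4" for x i
    using that unfolding cascade_def cascade_solution_def
    by (elim less_4_cases) (auto intro!: derivative_eq_intros simp: power2_eq_square eval_nat_numeral)
qed (auto simp: cascade_solution_def topspace_Euclidean_space fun_eq_iff)

text \<open>Because the system is triangular, the stage components needed here are exact monomials
  in \<open>h\<close>, and the counterexample requires no asymptotics.\<close>

lemma cascade_stage_0:
  assumes "i < 8"
  shows "rk_stage_vector butcher_A cascade (\<lambda>_. 0) h i 0 = h * butcher_c i"
  using butcher_row_sum[OF assms] by (subst rk_stage_vector.simps) (simp add: cascade_def)

lemma cascade_stage_1:
  assumes "i < 8"
  shows "rk_stage_vector butcher_A cascade (\<lambda>_. 0) h i 1
    = h ^ 3 * (\<Sum>j<i. butcher_A i j * butcher_c j ^ 2)"
proof -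
  let ?Y = "rk_stage_vector butcher_A cascade (\<lambda>_. 0) h"
  have "?Y i 1 = h * (\<Sum>j<i. butcher_A i j * (?Y j 0 * ?Y j 0))"
    by (subst rk_stage_vector.simps) (simp add: cascade_def)
  also have "(\<Sum>j<i. butcher_A i j * (?Y j 0 * ?Y j 0)) = (\<Sum>j<i. h ^ 2 * (butcher_A i j * butcher_c j ^ 2))"
    using assms by (intro sum.cong) (simp_all add: cascade_stage_0 power2_eq_square)
  finally show ?thesis by (simp add: sum_distrib_left[symmetric] eval_nat_numeral)
qed

lemma cascade_stage_2:
  assumes "i < 8"
  shows "rk_stage_vector butcher_A cascade (\<lambda>_. 0) h i 2
    = h ^ 4 * (\<Sum>j<i. butcher_A i j * (\<Sum>l<j. butcher_A j l * butcher_c l ^ 2))"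
proof -
  let ?Y = "rk_stage_vector butcher_A cascade (\<lambda>_. 0) h"
  have "?Y i 2 = h * (\<Sum>j<i. butcher_A i j * ?Y j 1)"
    by (subst rk_stage_vector.simps) (simp add: cascade_def)
  also have "(\<Sum>j<i. butcher_A i j * ?Y j 1)
      = (\<Sum>j<i. h ^ 3 * (butcher_A i j * (\<Sum>l<j. butcher_A j l * butcher_c l ^ 2)))"
    using assms by (intro sum.cong refl) (subst cascade_stage_1, simp_all)
  finally show ?thesis by (simp add: sum_distrib_left[symmetric] eval_nat_numeral)
qed

text \<open>Each product with \<open>A\<close> is replaced by an exact integral plus a defect. The
  integrals yield \<open>1/12 * 1/6\<close>, the fourth defect is orthogonal to \<open>b c\<close>,
  and the failing condition with \<open>A_defect_3\<close> is what remains.\<close>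

lemma cascade_condition:
  "(\<Sum>i<8. butcher_b i * (butcher_c i * (\<Sum>j<i. butcher_A i j * (\<Sum>l<j. butcher_A j l * butcher_c l ^ 2))))
    = 1/72 - (1/4140 + 1/27600 * sqrt 415)"
proof -
  have "(\<Sum>l<j. butcher_A j l * butcher_c l ^ 2) = defect_3 j + butcher_c j ^ 3 / 3" if "j < 8" for j
    using butcher_defect_3[OF that] by simp
  then have A: "(\<Sum>j<i. butcher_A i j * (\<Sum>l<j. butcher_A j l * butcher_c l ^ 2))
      = A_defect_3 i + (defect_4 i + butcher_c i ^ 4 / 4) / 3" if "i < 8" for i
  proof -
    have "(\<Sum>j<i. butcher_A i j * (\<Sum>l<j. butcher_A j l * butcher_c l ^ 2))
        = (\<Sum>j<i. butcher_A i j * (defect_3 j + butcher_c j ^ 3 / 3))"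
      using that \<open>\<And>j. j < 8 \<Longrightarrow> _\<close> by (intro sum.cong) auto
    also have "\<dots> = (\<Sum>j<i. butcher_A i j * defect_3 j) + (\<Sum>j<i. butcher_A i j * butcher_c j ^ 3) / 3"
      by (simp add: distrib_left sum.distrib sum_divide_distrib)
    also have "(\<Sum>j<i. butcher_A i j * butcher_c j ^ 3) = defect_4 i + butcher_c i ^ 4 / 4"
      using butcher_defect_4[OF that] by simp
    finally show ?thesis using butcher_A_defect_3[OF that] by simp
  qed
  have "(\<Sum>i<8. butcher_b i * (butcher_c i * (\<Sum>j<i. butcher_A i j * (\<Sum>l<j. butcher_A j l * butcher_c l ^ 2))))
     = (\<Sum>i<8. butcher_b i * (butcher_c i * A_defect_3 i) + (butcher_b i * (butcher_c i ^ 1 * defect_4 i)) / 3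
         + butcher_b i * butcher_c i ^ 5 / 12)"
  proof (intro sum.cong refl)
    fix i :: nat assume "i \<in> {..<8}"
    moreover have "butcher_c i ^ 5 = butcher_c i * butcher_c i ^ 4" by (simp add: eval_nat_numeral)
    ultimately show "butcher_b i * (butcher_c i * (\<Sum>j<i. butcher_A i j * (\<Sum>l<j. butcher_A j l * butcher_c l ^ 2)))
      = butcher_b i * (butcher_c i * A_defect_3 i) + (butcher_b i * (butcher_c i ^ 1 * defect_4 i)) / 3
         + butcher_b i * butcher_c i ^ 5 / 12"
      by (simp add: A algebra_simps)
  qed
  also have "\<dots> = - (1/4140 + 1/27600 * sqrt 415) + 1 / 72"
    using butcher_quadrature[of 5]
    unfolding sum.distrib sum_divide_distrib[symmetric] butcher_paired_conditions butcher_b_orthogonal by simp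
  finally show ?thesis by simp
qed

lemma cascade_step_error:
  "rk_step_vector 8 butcher_A butcher_b cascade (\<lambda>_. 0) h 3 - cascade_solution h 3
    = - (1/4140 + 1/27600 * sqrt 415) * h ^ 6"
proof -
  let ?Y = "rk_stage_vector butcher_A cascade (\<lambda>_. 0) h"
  have "rk_step_vector 8 butcher_A butcher_b cascade (\<lambda>_. 0) h 3
      = h * (\<Sum>i<8. butcher_b i * (?Y i 0 * ?Y i 2))"
    by (simp add: rk_step_vector_def cascade_def)
  also have "(\<Sum>i<8. butcher_b i * (?Y i 0 * ?Y i 2)) = (\<Sum>i<8. h ^ 5 * (butcher_b i *
      (butcher_c i * (\<Sum>j<i. butcher_A i j * (\<Sum>l<j. butcher_A j l * butcher_c l ^ 2)))))"
  proof (intro sum.cong refl)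
    fix i :: nat assume "i \<in> {..<8}"
    moreover have "h ^ 5 = h * h ^ 4" by (simp add: eval_nat_numeral)
    ultimately show "butcher_b i * (?Y i 0 * ?Y i 2) = h ^ 5 * (butcher_b i *
      (butcher_c i * (\<Sum>j<i. butcher_A i j * (\<Sum>l<j. butcher_A j l * butcher_c l ^ 2))))"
      by (simp add: cascade_stage_0 cascade_stage_2)
  qed
  also have "\<dots> = h ^ 5 * (1/72 - (1/4140 + 1/27600 * sqrt 415))"
    unfolding sum_distrib_left[symmetric] cascade_condition ..
  finally show ?thesis
    by (simp add: cascade_solution_def algebra_simps eval_nat_numeral)
qed

lemma butcher_not_order_6: "\<not> rk_order_vector 8 butcher_A butcher_b 6"
proof
  assume ord: "rk_order_vector 8 butcher_A butcher_b 6"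
  have "(\<lambda>h. L2_set (\<lambda>k. rk_step_vector 8 butcher_A butcher_b f y0 h k - y (x0 + h) k) {..<d})
      \<in> O[at 0](\<lambda>h. h ^ (6 + 1))"
    if "1 \<le> d" "smooth_near_vector d f y0" "solves_vector d f y0 x0 y" for d f y0 x0 y
    using ord that unfolding rk_order_vector_def by blast
  from this[OF _ smooth_cascade solves_cascade] have "(\<lambda>h. L2_set (\<lambda>k. rk_step_vector 8 butcher_A butcher_b cascade (\<lambda>_. 0) h k
      - cascade_solution (0 + h) k) {..<4}) \<in> O[at 0](\<lambda>h. h ^ (6 + 1))"
    by simp
  moreover have le: "\<bar>u 3\<bar> \<le> L2_set u {..<4}" for u :: "nat \<Rightarrow> real"
  proof -
    have "(u 3)\<^sup>2 \<le> (\<Sum>i<4. (u i)\<^sup>2)" by (rule member_le_sum) auto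
    then show ?thesis using real_sqrt_le_mono by (fastforce simp: L2_set_def)
  qed
  have "(\<lambda>h. rk_step_vector 8 butcher_A butcher_b cascade (\<lambda>_. 0) h 3 - cascade_solution h 3)
      \<in> O[at 0](\<lambda>h. L2_set (\<lambda>k. rk_step_vector 8 butcher_A butcher_b cascade (\<lambda>_. 0) h k
      - cascade_solution h k) {..<4})"
  proof (intro bigoI[of _ 1] always_eventually allI)
    fix h
    show "norm (rk_step_vector 8 butcher_A butcher_b cascade (\<lambda>_. 0) h 3 - cascade_solution h 3)
      \<le> 1 * norm (L2_set (\<lambda>k. rk_step_vector 8 butcher_A butcher_b cascade (\<lambda>_. 0) h k
          - cascade_solution h k) {..<4})"
      using le[of "\<lambda>k. rk_step_vector 8 butcher_A butcher_b cascade (\<lambda>_. 0) h k - cascade_solution h k"]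
      by (simp add: L2_set_nonneg)
  qed
  ultimately have "(\<lambda>h. - (1/4140 + 1/27600 * sqrt 415) * h ^ 6) \<in> O[at 0](\<lambda>h::real. h ^ 7)"
    unfolding cascade_step_error by (auto intro: landau_o.big_trans)
  \<comment> \<open>Both summands are positive, so the leading coefficient of the error cannot
    vanish.\<close>
  moreover have "1/4140 + 1/27600 * sqrt 415 > (0 :: real)" by (simp add: add_pos_pos)
  ultimately have "(\<lambda>h. h ^ 6) \<in> O[at 0](\<lambda>h::real. h ^ 7)"
    by (subst (asm) landau_o.big.cmult_in_iff) auto
  then obtain C where C: "C > 0" "\<forall>\<^sub>F h in at (0::real). norm (h ^ 6) \<le> C * norm (h ^ 7)"
    by (elim landau_o.bigE)
  have "\<forall>\<^sub>F h in at (0::real). \<bar>h\<bar> < 1 / C"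
    using C(1) by (auto simp: eventually_at dist_real_def intro!: exI[of _ "1 / C"])
  then have "\<forall>\<^sub>F h in at (0::real). False"
    using C(2) eventually_neq_at_within[of 0]
  proof eventually_elim
    case (elim h)
    have "\<bar>h\<bar> ^ 6 * 1 \<le> \<bar>h\<bar> ^ 6 * (C * \<bar>h\<bar>)"
      using elim(2) by (simp add: power_abs abs_mult eval_nat_numeral mult_ac)
    then have "1 \<le> C * \<bar>h\<bar>" using elim(3) by (subst (asm) mult_le_cancel_left_pos) auto
    then show False using elim(1) C(1) by (simp add: field_simps)
  qed
  then show False by simp
qed

section \<open>The orders of the method\<close>

lemma bigo_imp_tendsto:
  assumes "(\<lambda>h. u h - a) \<in> O[nhds 0](\<lambda>h::real. h)"
  shows "(u \<longlongrightarrow> (a::real)) (nhds 0)"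
proof -
  obtain C where "C > 0" and C: "\<forall>\<^sub>F h in nhds 0. norm (u h - a) \<le> C * norm h"
    using assms by (elim landau_o.bigE)
  have "((\<lambda>h::real. C * norm h) \<longlongrightarrow> C * norm (0::real)) (nhds 0)"
    by (intro tendsto_intros filterlim_ident)
  then have "((\<lambda>h. u h - a) \<longlongrightarrow> 0) (nhds 0)"
    using Lim_null_comparison[OF C] by simp
  then show ?thesis by (rule LIM_zero_cancel)
qed

lemma bounded_near:
  assumes U: "openin (Euclidean_space d) U" "z0 \<in> U" and g: "Ck_on d k U g"
    and W: "\<And>\<delta>. \<delta> > 0 \<Longrightarrow> \<forall>\<^sub>F h in Fl. W h \<in> box_nbhd d z0 \<delta>"
  shows "(\<lambda>h. g (W h)) \<in> O[Fl](\<lambda>_. 1)"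
proof -
  obtain \<delta> where \<delta>: "\<delta> > 0" "\<And>z. z \<in> box_nbhd d z0 \<delta> \<Longrightarrow> \<bar>g z - g z0\<bar> < 1"
    using continuous_map_box_nbhd[OF U Ck_on_imp_continuous[OF g], of 1] by (metis zero_less_one)
  show ?thesis
    using W[OF \<delta>(1)]
    by (intro bigoI[of _ "\<bar>g z0\<bar> + 1"], elim eventually_mono) (use \<delta>(2) in force)
qed

lemma quadratic_remainder_bigo:
  assumes U: "openin (Euclidean_space d) U" "z0 \<in> U"
    and g': "has_partials d U g g'" "\<And>i. i < d \<Longrightarrow> Ck_on d (Suc 0) U (g' i)"
    and Z: "\<And>\<delta>. \<delta> > 0 \<Longrightarrow> \<forall>\<^sub>F h in Fl. Z h \<in> box_nbhd d z0 \<delta>"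
    and W: "\<And>\<delta>. \<delta> > 0 \<Longrightarrow> \<forall>\<^sub>F h in Fl. W h \<in> box_nbhd d z0 \<delta>"
  shows "(\<lambda>h. g (W h) - g (Z h) - (\<Sum>l<d. g' l (Z h) * (W h l - Z h l)))
    \<in> O[Fl](\<lambda>h. (\<Sum>l<d. \<bar>W h l - Z h l\<bar>)\<^sup>2)"
proof -
  obtain \<delta> C where \<delta>: "\<delta> > 0" and "C \<ge> 0" "box_nbhd d z0 \<delta> \<subseteq> U"
    and rem: "\<forall>z\<in>box_nbhd d z0 \<delta>. \<forall>w\<in>box_nbhd d z0 \<delta>.
       \<bar>g w - g z - (\<Sum>l<d. g' l z * (w l - z l))\<bar> \<le> C * (\<Sum>l<d. \<bar>w l - z l\<bar>)\<^sup>2"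
    by (rule quadratic_remainder_box[OF U g'])
  show ?thesis
  proof (rule bigoI[of _ C])
    show "\<forall>\<^sub>F h in Fl. norm (g (W h) - g (Z h) - (\<Sum>l<d. g' l (Z h) * (W h l - Z h l)))
        \<le> C * norm ((\<Sum>l<d. \<bar>W h l - Z h l\<bar>)\<^sup>2)"
      using Z[OF \<delta>] W[OF \<delta>] by eventually_elim (use rem in simp)
  qed
qed

lemma tendsto_along_step:
  assumes "(u \<longlongrightarrow> a) (nhds (x0::real))"
  shows "((\<lambda>h. u (x0 + c * h)) \<longlongrightarrow> a) (nhds 0)"
proof -
  have "((\<lambda>h. x0 + c * h) \<longlongrightarrow> x0 + c * 0) (nhds 0)"
    by (intro tendsto_intros filterlim_ident)
  then show ?thesis using filterlim_compose[OF assms] by simp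
qed

lemma eventually_along_step:
  assumes "\<forall>\<^sub>F x in nhds (x0::real). P x"
  shows "\<forall>\<^sub>F h in nhds 0. P (x0 + c * h)"
proof -
  have "((\<lambda>h. x0 + c * h) \<longlongrightarrow> x0 + c * 0) (nhds 0)"
    by (intro tendsto_intros filterlim_ident)
  then show ?thesis using assms by (simp add: filterlim_iff)
qed

lemma taylor_increment:
  assumes y': "\<forall>\<^sub>F x in nhds x0. (y has_real_derivative y' x) (at x)"
    and "taylor N (\<lambda>h. y' (x0 + h)) a"
  shows "taylor (Suc N) (\<lambda>h. y (x0 + h) - y x0) (case_nat 0 (\<lambda>n. a n / real (Suc n)))"
proof -
  have "\<forall>\<^sub>F h in nhds 0. ((\<lambda>h. y (x0 + h) - y x0) has_real_derivative y' (x0 + h)) (at h)"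
    using eventually_nhds_shift[OF y']
  proof eventually_elim
    case (elim h)
    then have "((\<lambda>h. y (x0 + h)) has_real_derivative y' (x0 + h)) (at h)"
      by (simp add: DERIV_shift add.commute)
    then show ?case by (auto intro!: derivative_eq_intros)
  qed
  from taylor_antiderivative[OF this assms(2)] show ?thesis by simp
qed

lemma butcher_order_5: "rk_order_vector 8 butcher_A butcher_b 5"
  unfolding rk_order_vector_def
proof (intro allI impI)
  fix d :: nat and f y0 x0 y
  assume "1 \<le> d" and asm: "smooth_near_vector d f y0 \<and> solves_vector d f y0 x0 y"
  then obtain U where U: "openin (Euclidean_space d) U" "y0 \<in> U"
    and fU: "\<And>z. z \<in> U \<Longrightarrow> f z \<in> topspace (Euclidean_space d)"
    and sm: "\<And>i. i < d \<Longrightarrow> smooth_on d U (\<lambda>z. f z i)"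
    unfolding smooth_near_vector_def by blast
  from asm have yx0: "y x0 = y0" and top: "\<forall>\<^sub>F x in nhds x0. y x \<in> topspace (Euclidean_space d)"
    unfolding solves_vector_def by (auto elim!: eventually_mono)
  have der: "\<forall>\<^sub>F x in nhds x0. ((\<lambda>t. y t i) has_real_derivative f (y x) i) (at x)" if "i < d" for i
    using asm that unfolding solves_vector_def by (auto elim!: eventually_mono)
  have U': "y x0 \<in> U" using U(2) yx0 by simp
  have Cy: "Cn_near n (\<lambda>x. y x i) x0" if "i < d" for n i
    by (rule Cn_near_solution[where \<phi> = "\<lambda>i z. f z i", OF U(1) U' top sm der that])
  have Cg: "Cn_near n (\<lambda>x. g (y x)) x0" if "Ck_on d (Suc n) U g" for n g
    by (rule Cn_near_compose[where \<gamma> = y, OF U(1) U' top that Cy])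
  \<comment> \<open>Eight derivatives of the partials: an expansion to order 6 takes seven levels
    along the curve, and composition takes one more.\<close>
  have "\<exists>f'. has_partials d U (\<lambda>z. f z k) f' \<and> (\<forall>l<d. Ck_on d 8 U (f' l))" if "k < d" for k
    using Ck_on_Suc_partials[of d 8 U "\<lambda>z. f z k"] sm[OF that] unfolding smooth_on_def by metis
  then obtain f' where f': "\<And>k. k < d \<Longrightarrow> has_partials d U (\<lambda>z. f z k) (f' k)"
    "\<And>k l. k < d \<Longrightarrow> l < d \<Longrightarrow> Ck_on d 8 U (f' k l)" by metis
  have "\<exists>a. taylor 6 (\<lambda>h. f (y (x0 + h)) k) a" if "k < d" for k
    using Cn_near_imp_taylor[OF Cg[of "Suc 6" "\<lambda>z. f z k"]] sm[OF that] unfolding smooth_on_def by metis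
  then obtain F where F: "\<And>k. k < d \<Longrightarrow> taylor 6 (\<lambda>h. f (y (x0 + h)) k) (F k)" by metis
  have "\<exists>a. taylor 6 (\<lambda>h. f' k l (y (x0 + h))) a" if "k < d" "l < d" for k l
  proof -
    have "Ck_on d (Suc (Suc 6)) U (f' k l)" by (rule Ck_on_mono[OF f'(2)[OF that]]) simp
    from Cn_near_imp_taylor[OF Cg[OF this]] show ?thesis by blast
  qed
  then obtain J where J: "\<And>k l. k < d \<Longrightarrow> l < d \<Longrightarrow> taylor 6 (\<lambda>h. f' k l (y (x0 + h))) (J k l)" by metis
  let ?Y = "rk_stage_vector butcher_A f y0"
  have Yk: "?Y h i k - y0 k = h * (\<Sum>j<i. butcher_A i j * f (?Y h j) k)" for h i k
    by (subst rk_stage_vector.simps) simp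
  \<comment> \<open>The two claims need each other: earlier stages near \<open>y0\<close> give
    bounded slopes, hence an \<open>O(h)\<close> displacement, hence nearness of this stage.
    Membership in the space is part of nearness and comes from \<open>f\<close> mapping
    \<open>U\<close> into it.\<close>
  have stages: "(\<forall>k<d. (\<lambda>h. ?Y h i k - y0 k) \<in> O[nhds 0](\<lambda>h. h))
      \<and> (\<forall>\<delta>>0. \<forall>\<^sub>F h in nhds 0. ?Y h i \<in> box_nbhd d y0 \<delta>)" for i
  proof (induction i rule: less_induct)
    case (less i)
    have "(\<lambda>h. f (?Y h j) k) \<in> O[nhds 0](\<lambda>_. 1)" if "j < i" "k < d" for j k
    proof (rule bounded_near[where g = "\<lambda>z. f z k" and k = 0, OF U])
      show "Ck_on d 0 U (\<lambda>z. f z k)" using sm[OF that(2)] unfolding smooth_on_def by blast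
    qed (use that less in auto)
    then have "(\<lambda>h. \<Sum>j<i. butcher_A i j * f (?Y h j) k) \<in> O[nhds 0](\<lambda>_. 1)" if "k < d" for k
      using that by (intro big_sum_in_bigo bigo_cmult) auto
    then have 1: "(\<lambda>h. ?Y h i k - y0 k) \<in> O[nhds 0](\<lambda>h. h)" if "k < d" for k
      using bigo_id_mult[of _ 0] that unfolding Yk by simp
    obtain \<delta>0 where \<delta>0: "\<delta>0 > 0" "box_nbhd d y0 \<delta>0 \<subseteq> U" using box_nbhd_subset_openin[OF U] .
    have "\<forall>\<^sub>F h in nhds 0. \<forall>j\<in>{..<i}. ?Y h j \<in> box_nbhd d y0 \<delta>0"
      using less \<delta>0(1) by (intro eventually_ball_finite) auto
    then have "\<forall>\<^sub>F h in nhds 0. ?Y h i \<in> topspace (Euclidean_space d)"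
    proof eventually_elim
      case (elim h)
      then have "f (?Y h j) \<in> topspace (Euclidean_space d)" if "j < i" for j
        using \<delta>0(2) fU that by blast
      moreover have "y0 \<in> topspace (Euclidean_space d)" using U openin_subset by blast
      ultimately show ?case
        unfolding topspace_Euclidean_space using Yk[of h i] by (auto simp: algebra_simps)
    qed
    from eventually_in_box[OF this bigo_imp_tendsto[OF 1]] show ?case using 1 by blast
  qed
  have ybox: "\<forall>\<^sub>F h in nhds 0. y (x0 + c * h) \<in> box_nbhd d y0 \<delta>" if "\<delta> > 0" for \<delta> c
  proof (rule eventually_in_box[OF eventually_along_step[OF top] _ that])
    show "((\<lambda>h. y (x0 + c * h) i) \<longlongrightarrow> y0 i) (nhds 0)" if "i < d" for i
      using tendsto_along_step[OF Cn_near_imp_tendsto[OF Cy[OF that]]] yx0 by simp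
  qed
  interpret butcher_problem d "\<lambda>i k h. ?Y h i k - y0 k" "\<lambda>i k h. f (?Y h i) k"
    "\<lambda>k h. f (y (x0 + h)) k" "\<lambda>k h. y (x0 + h) k - y0 k" "\<lambda>k l h. f' k l (y (x0 + h))" F J
  proof
    fix i k :: nat assume "i < 8" and k: "k < d"
    show "(\<lambda>h. ?Y h i k - y0 k) \<in> O[nhds 0](\<lambda>h. h)" using stages k by blast
    have "(\<lambda>h. f (?Y h i) k - f (y (x0 + butcher_c i * h)) k
        - (\<Sum>l<d. f' k l (y (x0 + butcher_c i * h)) * (?Y h i l - y (x0 + butcher_c i * h) l)))
      \<in> O[nhds 0](\<lambda>h. (\<Sum>l<d. \<bar>?Y h i l - y (x0 + butcher_c i * h) l\<bar>)\<^sup>2)"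
    proof (rule quadratic_remainder_bigo[OF U f'(1)[OF k]])
      show "Ck_on d (Suc 0) U (f' k l)" if "l < d" for l
        by (rule Ck_on_mono[OF f'(2)[OF k that]]) simp
    qed (use ybox stages in auto)
    then show "(\<lambda>h. f (?Y h i) k - f (y (x0 + butcher_c i * h)) k
        - (\<Sum>l<d. f' k l (y (x0 + butcher_c i * h)) * (?Y h i l - y0 l - (y (x0 + butcher_c i * h) l - y0 l))))
      \<in> O[nhds 0](\<lambda>h. (\<Sum>l<d. \<bar>?Y h i l - y0 l - (y (x0 + butcher_c i * h) l - y0 l)\<bar>)\<^sup>2)"
      by simp
  next
    fix k assume k: "k < d"
    show "taylor 7 (\<lambda>h. y (x0 + h) k - y0 k) (case_nat 0 (\<lambda>n. F k n / real (Suc n)))"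
      using taylor_increment[OF der[OF k] F[OF k]] yx0 by simp
  qed (use Yk F J in auto)
  have "(\<lambda>h. rk_step_vector 8 butcher_A butcher_b f y0 h k - y (x0 + h) k) \<in> O[nhds 0](\<lambda>h. h ^ 6)"
    if "k < d" for k
    using step_error_order_5[OF that, unfolded step_error_def[abs_def]]
    by (simp add: rk_step_vector_def algebra_simps)
  then have "(\<lambda>h. \<Sum>k<d. \<bar>rk_step_vector 8 butcher_A butcher_b f y0 h k - y (x0 + h) k\<bar>)
      \<in> O[nhds 0](\<lambda>h. h ^ 6)"
    by (intro big_sum_in_bigo) auto
  then have "(\<lambda>h. L2_set (\<lambda>k. rk_step_vector 8 butcher_A butcher_b f y0 h k - y (x0 + h) k) {..<d})
      \<in> O[nhds 0](\<lambda>h. h ^ 6)"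
    by (rule landau_o.big_trans[rotated])
      (auto intro!: bigoI[of _ 1] always_eventually simp: L2_set_nonneg L2_set_le_sum_abs sum_nonneg)
  from landau_o.big.filter_mono[OF _ this, of "at 0"]
  show "(\<lambda>h. L2_set (\<lambda>k. rk_step_vector 8 butcher_A butcher_b f y0 h k - y (x0 + h) k) {..<d})
      \<in> O[at 0](\<lambda>h. h ^ (5 + 1))"
    by (simp add: at_within_def)
qed

definition pt :: "real \<Rightarrow> real \<Rightarrow> nat \<Rightarrow> real" where
  "pt u x = (\<lambda>_. 0)(0 := u, 1 := x)"

lemma pt_simps [simp]: "pt u x 0 = u" "pt u x (Suc 0) = x"
  by (simp_all add: pt_def)

lemma pt_in_topspace: "pt u x \<in> topspace (Euclidean_space 2)"
  by (simp add: pt_def topspace_Euclidean_space)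

lemma butcher_scalar_order_6: "rk_order_scalar 8 butcher_A butcher_b butcher_c 6"
  unfolding rk_order_scalar_def
proof (intro allI impI)
  fix f y0 x0 y
  assume asm: "smooth_near_scalar f y0 x0 \<and> solves_scalar f y0 x0 y"
  define g where "g z = f (z 0) (z 1)" for z :: "nat \<Rightarrow> real"
  have g_pt [simp]: "g (pt u x) = f u x" for u x by (simp add: g_def)
  define \<gamma> where "\<gamma> x = pt (y x) x" for x
  from asm obtain U where U: "openin (Euclidean_space 2) U" "pt y0 x0 \<in> U"
    and sm: "smooth_on 2 U g"
    unfolding smooth_near_scalar_def pt_def[symmetric] g_def[abs_def] by blast
  from asm have yx0: "y x0 = y0"
    and y': "\<forall>\<^sub>F x in nhds x0. (y has_real_derivative f (y x) x) (at x)"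
    unfolding solves_scalar_def by auto
  have U': "\<gamma> x0 \<in> U" using U(2) yx0 by (simp add: \<gamma>_def)
  have top: "\<forall>\<^sub>F x in nhds x0. \<gamma> x \<in> topspace (Euclidean_space 2)"
    by (simp add: \<gamma>_def pt_in_topspace)
  \<comment> \<open>The autonomous field solved by the curve \<open>(y x, x)\<close>. It serves only
    to establish smoothness along the solution; the error analysis stays one-dimensional.\<close>
  define \<phi> where "\<phi> i = (if i = 0 then g else (\<lambda>_. 1))" for i :: nat
  have "\<forall>\<^sub>F x in nhds x0. ((\<lambda>x. \<gamma> x i) has_real_derivative \<phi> i (\<gamma> x)) (at x)" if "i < 2" for i
  proof (cases "i = 0")
    case False
    then have "i = Suc 0" using that by simp
    then show ?thesis by (simp add: \<gamma>_def \<phi>_def)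
  qed (use y' in \<open>simp add: \<gamma>_def \<phi>_def\<close>)
  moreover have "smooth_on 2 U (\<phi> i)" for i
    using sm by (simp add: \<phi>_def smooth_on_def Ck_on_const)
  ultimately have Cy: "Cn_near n (\<lambda>x. \<gamma> x i) x0" if "i < 2" for n i
    using that by (intro Cn_near_solution[where \<phi> = \<phi> and \<gamma> = \<gamma>, OF U(1) U' top]) auto
  have Cg: "Cn_near n (\<lambda>x. u (\<gamma> x)) x0" if "Ck_on 2 (Suc n) U u" for n u
    by (rule Cn_near_compose[where \<gamma> = \<gamma>, OF U(1) U' top that Cy])
  have Cg9: "Ck_on 2 (Suc 8) U g" using sm unfolding smooth_on_def by blast
  obtain g' where g': "has_partials 2 U g g'" "\<And>l. l < 2 \<Longrightarrow> Ck_on 2 8 U (g' l)"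
    using Ck_on_Suc_partials[OF Cg9] by blast
  have "Ck_on 2 (Suc (Suc 6)) U g" by (rule Ck_on_mono[OF Cg9]) simp
  from Cn_near_imp_taylor[OF Cg[OF this]] obtain F where F: "taylor 6 (\<lambda>h. g (\<gamma> (x0 + h))) F" .
  have "Ck_on 2 (Suc (Suc 6)) U (g' 0)" by (rule Ck_on_mono[OF g'(2)]) simp_all
  from Cn_near_imp_taylor[OF Cg[OF this]] obtain J where J: "taylor 6 (\<lambda>h. g' 0 (\<gamma> (x0 + h))) J" .
  let ?Y = "rk_stage_scalar butcher_A butcher_c f y0 x0"
  have Yi: "?Y h i - y0 = h * (\<Sum>j<i. butcher_A i j * f (?Y h j) (x0 + butcher_c j * h))" for h i
    by (subst rk_stage_scalar.simps) simp
  define P where "P i h = pt (?Y h i) (x0 + butcher_c i * h)" for i h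
  have stages: "(\<lambda>h. ?Y h i - y0) \<in> O[nhds 0](\<lambda>h. h)
      \<and> (\<forall>\<delta>>0. \<forall>\<^sub>F h in nhds 0. P i h \<in> box_nbhd 2 (pt y0 x0) \<delta>)" for i
  proof (induction i rule: less_induct)
    case (less i)
    have "(\<lambda>h. g (P j h)) \<in> O[nhds 0](\<lambda>_. 1)" if "j < i" for j
      by (rule bounded_near[OF U Cg9]) (use that less in auto)
    then have "(\<lambda>h. \<Sum>j<i. butcher_A i j * f (?Y h j) (x0 + butcher_c j * h)) \<in> O[nhds 0](\<lambda>_. 1)"
      by (intro big_sum_in_bigo bigo_cmult) (auto simp: P_def)
    then have 1: "(\<lambda>h. ?Y h i - y0) \<in> O[nhds 0](\<lambda>h. h)"
      using bigo_id_mult[of _ 0] unfolding Yi by simp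
    have "((\<lambda>h. x0 + butcher_c i * h) \<longlongrightarrow> x0) (nhds 0)"
      by (rule tendsto_along_step[OF filterlim_ident])
    with bigo_imp_tendsto[OF 1] have "((\<lambda>h. P i h l) \<longlongrightarrow> pt y0 x0 l) (nhds 0)" if "l < 2" for l
      using that by (auto simp: P_def numeral_2_eq_2 less_Suc_eq)
    with eventually_in_box[where W = "P i" and d = 2] 1 show ?case
      by (auto simp: P_def pt_in_topspace)
  qed
  have \<gamma>box: "\<forall>\<^sub>F h in nhds 0. \<gamma> (x0 + c * h) \<in> box_nbhd 2 (pt y0 x0) \<delta>" if "\<delta> > 0" for \<delta> c
  proof (rule eventually_in_box[OF eventually_along_step[OF top] _ that])
    show "((\<lambda>h. \<gamma> (x0 + c * h) i) \<longlongrightarrow> pt y0 x0 i) (nhds 0)" if "i < 2" for i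
      using tendsto_along_step[OF Cn_near_imp_tendsto[OF Cy[OF that]]] yx0 by (simp add: \<gamma>_def)
  qed
  interpret butcher_scalar_problem "\<lambda>i k h. ?Y h i - y0" "\<lambda>i k h. g (P i h)"
    "\<lambda>k h. g (\<gamma> (x0 + h))" "\<lambda>k h. y (x0 + h) - y0" "\<lambda>k l h. g' 0 (\<gamma> (x0 + h))" "\<lambda>_. F" "\<lambda>_ _. J"
  proof unfold_locales
    fix i :: nat
    show "(\<lambda>h. ?Y h i - y0) \<in> O[nhds 0](\<lambda>h. h)" using stages by blast
    have "(\<lambda>h. g (P i h) - g (\<gamma> (x0 + butcher_c i * h))
        - (\<Sum>l<2. g' l (\<gamma> (x0 + butcher_c i * h)) * (P i h l - \<gamma> (x0 + butcher_c i * h) l)))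
      \<in> O[nhds 0](\<lambda>h. (\<Sum>l<2. \<bar>P i h l - \<gamma> (x0 + butcher_c i * h) l\<bar>)\<^sup>2)"
    proof (rule quadratic_remainder_bigo[OF U g'(1)])
      show "Ck_on 2 (Suc 0) U (g' l)" if "l < 2" for l
        by (rule Ck_on_mono[OF g'(2)[OF that]]) simp
    qed (use \<gamma>box stages in auto)
    \<comment> \<open>Stage point and solution point have the same abscissa, so the second
      coordinate drops out of both sums and only the partial in \<open>y\<close> is left.\<close>
    then show "(\<lambda>h. g (P i h) - g (\<gamma> (x0 + butcher_c i * h))
        - (\<Sum>l<Suc 0. g' 0 (\<gamma> (x0 + butcher_c i * h)) * (?Y h i - y0 - (y (x0 + butcher_c i * h) - y0))))
      \<in> O[nhds 0](\<lambda>h. (\<Sum>l<Suc 0. \<bar>?Y h i - y0 - (y (x0 + butcher_c i * h) - y0)\<bar>)\<^sup>2)"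
      by (simp add: numeral_2_eq_2 P_def \<gamma>_def)
  next
    have "taylor 6 (\<lambda>h. f (y (x0 + h)) (x0 + h)) F" using F by (simp add: \<gamma>_def)
    from taylor_increment[OF y' this]
    show "taylor 7 (\<lambda>h. y (x0 + h) - y0) (case_nat 0 (\<lambda>n. F n / real (Suc n)))"
      using yx0 by simp
  qed (use Yi F J in \<open>auto simp: P_def\<close>)
  have "(\<lambda>h. rk_step_scalar 8 butcher_A butcher_b butcher_c f y0 x0 h - y (x0 + h)) \<in> O[nhds 0](\<lambda>h. h ^ 7)"
    using step_error_order_6[unfolded step_error_def[abs_def]]
    by (simp add: rk_step_scalar_def P_def algebra_simps)
  from landau_o.big.filter_mono[OF _ this, of "at 0"]
  show "(\<lambda>h. rk_step_scalar 8 butcher_A butcher_b butcher_c f y0 x0 h - y (x0 + h))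
      \<in> O[at 0](\<lambda>h. h ^ (6 + 1))"
    by (simp add: at_within_def)
qed

theorem mainTheorem4:
  shows "rk_order_scalar 8 butcher_A butcher_b butcher_c 6 \<and>
         rk_order_vector 8 butcher_A butcher_b 5 \<and>
         \<not> rk_order_vector 8 butcher_A butcher_b 6"
  using butcher_scalar_order_6 butcher_order_5 butcher_not_order_6 by blast

end
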